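(* For every $r\in\mathbb{N}$ there exist constants $c_{r,1},c_{r,2}>0$ (depending only on $r$) such that for all $d,n\in\mathbb{N}$ with $n=m^d$ for some $m\in\mathbb{N}$, $$ \min\left\{\tfrac12,\; c_{r,1}\,d\,n^{-r/d}\right\}\;\le\; e_n(\mathcal{C}^r_d)\;\le\;\min\left\{1,\; c_{r,2}\,d\,n^{-r/d}\right\}. $$ The lower bound holds for all $n\in\mathbb{N}$ (and all $d\in\mathbb{N}$), whereas for general $n\in\mathbb{N}$ the upper bound has to be replaced by $$ e_n(\mathcal{C}^r_d)\le\min\left\{1,\; c_{r,2}\,d\,(n^{1/d}-1)^{-r}\right\}, $$ where for $n=1$ the right-hand side is read as $1$.
   Context: Here $\mathbb{N}=\{1,2,\dots\}$, $\mathbb{N}_0=\{0,1,2,\dots\}$, and $|\beta|_1=\beta_1+\dots+\beta_d$ for $\beta\in\mathbb{N}_0^d$; $D^\beta$ is the partial derivative of order $\beta$. Let $\mathcal{C}^r_d$ be the class of all $r$-times continuously differentiable functions $f:[0,1]^d\to\mathbb{R}$ with $\sup_{x\in[0,1]^d}|(D^\beta f)(x)|\le 1$ for all $\beta\in\mathbb{N}_0^d$ with $|\beta|_1\le r$. The problem is to approximate $S_d(f)=\int_{[0,1]^d} f(x)\,dx$ for $f\in\mathcal{C}^r_d$. An algorithm using $n$ function values is a map $A_n:\mathcal{C}^r_d\to\mathbb{R}$ of the form $A_n(f)=\phi_n(f(x_1),\dots,f(x_n))$, where $\phi_n:\mathbb{R}^n\to\mathbb{R}$ is an arbitrary (possibly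 nonlinear) map and the sample points $x_i\in[0,1]^d$ may be chosen adaptively, i.e., $x_i$ may depend on the already computed values $f(x_1),\dots,f(x_{i-1})$. Its worst case error is $e(A_n)=\sup_{f\in\mathcal{C}^r_d}|S_d(f)-A_n(f)|$, and the $n$th minimal error is $e_n(\mathcal{C}^r_d)=\inf_{A_n}e(A_n)$, the infimum being over all such algorithms. *)

theory Defs
  imports "HOL-Analysis.Analysis"
begin

text \<open>
  The dimension \<open>d\<close> is quantified after the constants in the main statement, so it is a natural
  number and not a type. A point of \<open>\<real>\<^sup>d\<close> is a function \<open>nat \<Rightarrow> real\<close> that is extensional on
  \<open>{..<d}\<close>; coordinates are numbered from \<open>0\<close>. On such points the product topology of
  \<open>nat \<Rightarrow> real\<close> is the usual topology of \<open>\<real>\<^sup>d\<close>.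
\<close>

definition cube :: "nat \<Rightarrow> (nat \<Rightarrow> real) set" where
  "cube d = (\<Pi>\<^sub>E i\<in>{..<d}. {0..1})"

definition integral_cube :: "nat \<Rightarrow> ((nat \<Rightarrow> real) \<Rightarrow> real) \<Rightarrow> real" where
  "integral_cube d f = (LINT x:cube d|(\<Pi>\<^sub>M i\<in>{..<d}. lborel). f x)"

text \<open>Derivatives are taken within the cube, hence are one-sided on its faces.\<close>

definition partial_deriv :: "nat \<Rightarrow> ((nat \<Rightarrow> real) \<Rightarrow> real) \<Rightarrow> (nat \<Rightarrow> real) \<Rightarrow> real" where
  "partial_deriv i f x = vector_derivative (\<lambda>t. f (x(i := t))) (at (x i) within {0..1})"

primrec cont_diff :: "nat \<Rightarrow> nat \<Rightarrow> ((nat \<Rightarrow> real) \<Rightarrow> real) \<Rightarrow> bool" where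
  "cont_diff d 0 f \<longleftrightarrow> continuous_on (cube d) f"
| "cont_diff d (Suc r) f \<longleftrightarrow> continuous_on (cube d) f \<and>
     (\<forall>i<d. (\<forall>x\<in>cube d. (\<lambda>t. f (x(i := t))) differentiable (at (x i) within {0..1})) \<and>
            cont_diff d r (partial_deriv i f))"

text \<open>
  The derivative \<open>D\<^sup>\<beta>\<close>. The coordinates are processed in a fixed order, which is immaterial for
  functions satisfying \<open>cont_diff d r\<close> and \<open>|\<beta>|\<^sub>1 \<le> r\<close>. Only the entries \<open>\<beta> i\<close> with \<open>i < d\<close> matter.
\<close>

definition multi_deriv ::
    "nat \<Rightarrow> (nat \<Rightarrow> nat) \<Rightarrow> ((nat \<Rightarrow> real) \<Rightarrow> real) \<Rightarrow> (nat \<Rightarrow> real) \<Rightarrow> real" where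
  "multi_deriv d \<beta> f = foldr (\<lambda>i. partial_deriv i ^^ \<beta> i) [0..<d] f"

text \<open>
  Functions are total on \<open>nat \<Rightarrow> real\<close>, but membership in the class, the integral and the sampled
  values only depend on their restriction to the cube.
\<close>

definition smooth_class :: "nat \<Rightarrow> nat \<Rightarrow> ((nat \<Rightarrow> real) \<Rightarrow> real) set" where
  "smooth_class r d = {f. cont_diff d r f \<and>
     (\<forall>\<beta>. (\<Sum>i<d. \<beta> i) \<le> r \<longrightarrow> (\<forall>x\<in>cube d. \<bar>multi_deriv d \<beta> f x\<bar> \<le> 1))}"

text \<open>
  An adaptive choice of sample points is a map \<open>X\<close> sending the list of the values computed so far
  to the next sample point.
\<close>

primrec sample_values ::
    "(real list \<Rightarrow> nat \<Rightarrow> real) \<Rightarrow> ((nat \<Rightarrow> real) \<Rightarrow> real) \<Rightarrow> nat \<Rightarrow> real list" where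
  "sample_values X f 0 = []"
| "sample_values X f (Suc k) = sample_values X f k @ [f (X (sample_values X f k))]"

definition algorithms :: "nat \<Rightarrow> nat \<Rightarrow> (((nat \<Rightarrow> real) \<Rightarrow> real) \<Rightarrow> real) set" where
  "algorithms d n = {\<lambda>f. \<phi> (sample_values X f n) | X \<phi>. \<forall>ys. length ys < n \<longrightarrow> X ys \<in> cube d}"

text \<open>Errors are extended reals, since the error of an individual algorithm may be infinite.\<close>

definition worst_case_error ::
    "nat \<Rightarrow> nat \<Rightarrow> (((nat \<Rightarrow> real) \<Rightarrow> real) \<Rightarrow> real) \<Rightarrow> ereal" where
  "worst_case_error r d A = (SUP f\<in>smooth_class r d. ereal \<bar>integral_cube d f - A f\<bar>)"

definition minimal_error :: "nat \<Rightarrow> nat \<Rightarrow> nat \<Rightarrow> ereal" where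
  "minimal_error r d n = (INF A\<in>algorithms d n. worst_case_error r d A)"

end

theory Submission
  imports Defs "HOL-Computational_Algebra.Polynomial"
begin

text \<open>
  Upper bound. On the unit interval there is, for every \<open>r\<close>, a quadrature rule with nonnegative
  weights that is exact on polynomials of degree less than \<open>r\<close> (\<open>positive_quadrature_rule\<close>): the
  midpoint rule errs by \<open>O(1 / N\<^sup>2)\<close> on polynomials, which is of smaller order than its weights
  \<open>1 / N\<close>, so it can be made exact by changing \<open>r\<close> of its weights without losing positivity. Repeating
  the rule on equal cells gives error \<open>O(m ^ (- r))\<close> with \<open>m\<close> nodes, by Taylor's formula. In the
  \<open>d\<close>-fold product rule with \<open>m ^ d\<close> nodes the errors of the coordinates merely add up, because
  nonnegative weights with sum 1 never amplify an error (\<open>product_rule_error\<close>). This explains the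
  factor \<open>d\<close>. Together with the zero algorithm, whose error is at most 1, this gives
  \<open>minimal_error_upper_bound\<close>; for general \<open>n\<close> the largest \<open>m\<close> with \<open>m ^ d \<le> n\<close> is used.

  Lower bound. It suffices to find, for any \<open>n\<close> points, a function \<open>f\<close> that vanishes at these points,
  lies in the class together with \<open>- f\<close>, and has a large integral: no algorithm that samples these
  points distinguishes \<open>f\<close> from \<open>- f\<close> (\<open>minimal_error_ge\<close>). Such an \<open>f\<close> has to have height of order
  \<open>d \<delta> ^ r\<close> with \<open>\<delta>\<close> of order \<open>n powr (- 1 / d)\<close>, although it varies on the length scale \<open>\<delta>\<close>. It is
  obtained by applying a cutoff to the function
  \<open>u(x) = - (1 / d) ln (\<Sum>\<^sub>k \<Prod>\<^sub>j sech ((x\<^sub>j - y\<^sub>k\<^sub>j) / \<delta>))\<close>, a soft minimum of distances from the points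
  \<open>y\<^sub>k\<close>, and scaling the result. Two facts make it work. The sum inside the logarithm has integral at most
  \<open>n (4 \<delta>) ^ d\<close>; if \<open>\<delta>\<close> is a small multiple of \<open>n powr (- 1 / d)\<close>, the sum is exponentially small in
  \<open>d\<close> on most of the cube, hence \<open>u\<close> is at least a positive constant there, whereas \<open>u \<le> 0\<close> at the
  given points. And all partial derivatives of \<open>u\<close> of order \<open>j \<ge> 1\<close> are bounded by a constant times
  \<open>1 / (d \<delta> ^ j)\<close>, where the constant depends neither on \<open>d\<close> nor on \<open>n\<close>: up to the factor \<open>1 / d\<close>, the
  derivatives of the logarithm are polynomial expressions in averages, with respect to
  weights of sum 1, of bounded functions (\<open>deriv_bound_average\<close>). The factor \<open>1 / d\<close> survives the cutoff
  by the chain rule and is what allows the height to contain the factor \<open>d\<close>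
  (\<open>fooling_function\<close>).
\<close>

section \<open>The unit cube\<close>

lemma cube_component: "x \<in> cube d \<Longrightarrow> i < d \<Longrightarrow> x i \<in> {0..1}"
  by (auto simp: cube_def PiE_iff)

lemma cube_upd: "x \<in> cube d \<Longrightarrow> i < d \<Longrightarrow> t \<in> {0..1} \<Longrightarrow> x(i := t) \<in> cube d"
  by (auto simp: cube_def PiE_iff extensional_def)

lemma cube_Suc_upd: "x \<in> cube d \<Longrightarrow> t \<in> {0..1} \<Longrightarrow> x(d := t) \<in> cube (Suc d)"
  by (auto simp: cube_def PiE_iff extensional_def)

lemma compact_cube: "compact (cube d)"
proof -
  have "cube d = PiE UNIV (\<lambda>i. if i < d then {0..1} else {undefined})"
  proof (intro set_eqI iffI)
    fix x assume "x \<in> PiE UNIV (\<lambda>i. if i < d then {0..1} else {undefined :: real})"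
    then have "x i \<in> (if i < d then {0..1} else {undefined})" for i
      by (rule PiE_mem) simp
    then show "x \<in> cube d"
      unfolding cube_def by (intro PiE_I) (smt (verit) lessThan_iff singletonD)+
  qed (auto simp: cube_def PiE_iff extensional_def)
  then have "compactin (product_topology (\<lambda>_. euclidean) UNIV) (cube d)"
    by (auto simp: compactin_PiE)
  then show ?thesis
    by (simp add: euclidean_product_topology)
qed

lemma continuous_on_upd:
  assumes "continuous_on S g" "continuous_on S h"
  shows "continuous_on S (\<lambda>z. (g z)(i := h z :: real))"
proof (rule continuous_on_coordinatewise_then_product)
  fix j
  show "continuous_on S (\<lambda>z. ((g z)(i := h z)) j)"
    using assms by (cases "j = i") (auto intro: continuous_on_product_then_coordinatewise)
qed

lemma continuous_on_cube_slice:
  fixes f :: "(nat \<Rightarrow> real) \<Rightarrow> real"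
  assumes "continuous_on (cube (Suc d)) f" "t \<in> {0..1}"
  shows "continuous_on (cube d) (\<lambda>x. f (x(d := t)))"
  by (rule continuous_on_compose2[OF assms(1)])
     (use assms(2) in \<open>auto intro!: continuous_on_upd continuous_on_id continuous_on_const cube_Suc_upd\<close>)

lemma continuous_on_cube_line_last:
  fixes f :: "(nat \<Rightarrow> real) \<Rightarrow> real"
  assumes "continuous_on (cube (Suc d)) f" "x \<in> cube d"
  shows "continuous_on {0..1} (\<lambda>t. f (x(d := t)))"
  by (rule continuous_on_compose2[OF assms(1)])
     (use assms(2) in \<open>auto intro!: continuous_on_upd continuous_on_id continuous_on_const cube_Suc_upd\<close>)

section \<open>Integration over the cube\<close>

interpretation lborel_product: product_sigma_finite "\<lambda>_ :: nat. lborel :: real measure"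
  by standard

lemma cube_sets: "cube d \<in> sets (\<Pi>\<^sub>M i\<in>{..<d}. lborel)"
  unfolding cube_def by (intro sets_PiM_I_finite) auto

lemma measure_cube: "measure (\<Pi>\<^sub>M i\<in>{..<d}. lborel) (cube d) = 1"
  and emeasure_cube: "emeasure (\<Pi>\<^sub>M i\<in>{..<d}. lborel) (cube d) = 1"
  using lborel_product.emeasure_PiM[of "{..<d}" "\<lambda>_. {0..1}"]
  by (simp_all add: cube_def measure_def)

text \<open>
  Continuity refers to the product topology on all of \<open>nat \<Rightarrow> real\<close>, the integral to the product
  measure over \<open>{..<d}\<close>. The identity between the two spaces is measurable because a coordinate
  outside \<open>{..<d}\<close> is constant on the extensional functions.
\<close>

lemma borel_measurable_cube:
  assumes "continuous_on (cube d) (f :: _ \<Rightarrow> real)"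
  shows "(\<lambda>x. indicator (cube d) x *\<^sub>R f x) \<in> borel_measurable (\<Pi>\<^sub>M i\<in>{..<d}. lborel)"
proof -
  have "(\<lambda>x. indicator (cube d) x *\<^sub>R f x) \<in> borel_measurable borel"
    by (intro borel_measurable_continuous_on_indicator assms borel_closed compact_imp_closed compact_cube)
  have "(\<lambda>x. x) \<in> (\<Pi>\<^sub>M i\<in>{..<d}. (lborel :: real measure)) \<rightarrow>\<^sub>M (borel :: (nat \<Rightarrow> real) measure)"
  proof (rule measurable_coordinatewise_then_product)
    fix i
    show "(\<lambda>x. x i) \<in> borel_measurable (\<Pi>\<^sub>M i\<in>{..<d}. (lborel :: real measure))"
    proof (cases "i < d")
      case True
      then show ?thesis
        using measurable_component_singleton[of i "{..<d}" "\<lambda>_. lborel :: real measure"] by simp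
    next
      case False
      have "(\<lambda>x. undefined) \<in> borel_measurable (\<Pi>\<^sub>M i\<in>{..<d}. (lborel :: real measure))"
        by simp
      then show ?thesis
        using False by (subst measurable_cong) (auto simp: space_PiM PiE_iff extensional_def)
    qed
  qed
  from measurable_compose[OF this \<open>(\<lambda>x. indicator (cube d) x *\<^sub>R f x) \<in> borel_measurable borel\<close>]
  show ?thesis .
qed

lemma continuous_imp_integrable_cube:
  assumes "continuous_on (cube d) (f :: _ \<Rightarrow> real)"
  shows "set_integrable (\<Pi>\<^sub>M i\<in>{..<d}. lborel) (cube d) f"
proof -
  obtain B where B: "\<And>x. x \<in> cube d \<Longrightarrow> norm (f x) \<le> B"
    using compact_imp_bounded[OF compact_continuous_image[OF assms compact_cube]]
    by (auto simp: bounded_iff)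
  have "set_integrable (\<Pi>\<^sub>M i\<in>{..<d}. lborel) (cube d) (\<lambda>_. B)"
    using cube_sets[of d] emeasure_cube[of d] by (simp add: set_integrable_def)
  moreover have "norm (indicator (cube d) x *\<^sub>R f x) \<le> norm (indicator (cube d) x *\<^sub>R B)" for x
    using B[of x] by (cases "x \<in> cube d") auto
  ultimately show ?thesis
    unfolding set_integrable_def
    by (intro Bochner_Integration.integrable_bound[OF _ borel_measurable_cube[OF assms]] AE_I2)
qed

lemma integral_cube_mono:
  assumes "continuous_on (cube d) f" "continuous_on (cube d) g"
    and "\<And>x. x \<in> cube d \<Longrightarrow> f x \<le> g x"
  shows "integral_cube d f \<le> integral_cube d g"
  unfolding integral_cube_def
  using assms by (intro set_integral_mono continuous_imp_integrable_cube)

lemma integral_cube_const: "integral_cube d (\<lambda>_. c) = c"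
  using cube_sets[of d] emeasure_cube[of d]
  by (simp add: integral_cube_def set_lebesgue_integral_def measure_cube)

lemma integral_cube_add:
  assumes "continuous_on (cube d) f" "continuous_on (cube d) g"
  shows "integral_cube d (\<lambda>x. f x + g x) = integral_cube d f + integral_cube d g"
  unfolding integral_cube_def
  by (intro set_integral_add continuous_imp_integrable_cube assms)

lemma integral_cube_cmult: "integral_cube d (\<lambda>x. c * f x) = c * integral_cube d f"
  unfolding integral_cube_def by simp

lemma integral_cube_diff:
  assumes "continuous_on (cube d) f" "continuous_on (cube d) g"
  shows "integral_cube d (\<lambda>x. f x - g x) = integral_cube d f - integral_cube d g"
  unfolding integral_cube_def
  by (intro set_integral_diff continuous_imp_integrable_cube assms)

lemma integral_cube_sum:
  assumes "\<And>k. k \<in> K \<Longrightarrow> continuous_on (cube d) (f k)"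
  shows "integral_cube d (\<lambda>x. \<Sum>k\<in>K. f k x) = (\<Sum>k\<in>K. integral_cube d (f k))"
  using assms
  by (induction K rule: infinite_finite_induct)
     (simp_all add: integral_cube_const integral_cube_add continuous_on_sum)

lemma integral_cube_cong:
  assumes "\<And>x. x \<in> cube d \<Longrightarrow> f x = g x"
  shows "integral_cube d f = integral_cube d g"
  unfolding integral_cube_def
  using assms cube_sets[of d] by (intro set_lebesgue_integral_cong) auto

lemma abs_integral_cube_le:
  assumes "continuous_on (cube d) f" and "\<And>x. x \<in> cube d \<Longrightarrow> \<bar>f x\<bar> \<le> B"
  shows "\<bar>integral_cube d f\<bar> \<le> B"
proof -
  have "integral_cube d f \<le> integral_cube d (\<lambda>_. B)"
    using assms by (intro integral_cube_mono) (auto simp: abs_le_iff)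
  moreover have "integral_cube d (\<lambda>_. - B) \<le> integral_cube d f"
    using assms by (intro integral_cube_mono) (force simp: abs_le_iff)+
  ultimately show ?thesis
    by (simp add: integral_cube_const)
qed

lemma set_lebesgue_integral_unit_interval:
  assumes "continuous_on {0..1} (f :: real \<Rightarrow> real)"
  shows "(LINT t:{0..1}|lborel. f t) = integral {0..1} f"
  by (rule set_borel_integral_eq_integral(2)[OF borel_integrable_atLeastAtMost'[OF assms]])

text \<open>
  Fubini's theorem, splitting off the last coordinate. Together with the continuity of the inner
  integral below it allows product rules to be analysed by induction on the dimension.
\<close>

lemma integral_cube_Suc:
  fixes f :: "(nat \<Rightarrow> real) \<Rightarrow> real"
  assumes "continuous_on (cube (Suc d)) f"
  shows "integral_cube (Suc d) f = integral_cube d (\<lambda>x. integral {0..1} (\<lambda>t. f (x(d := t))))"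
proof -
  have split: "indicator (cube (Suc d)) (x(d := t)) = indicator (cube d) x * (indicator {0..1} t :: real)"
    if "x \<in> space (\<Pi>\<^sub>M i\<in>{..<d}. (lborel :: real measure))" for x and t :: real
  proof -
    have "x(d := t) \<in> cube (Suc d) \<longleftrightarrow> x \<in> cube d \<and> t \<in> {0..1}"
      using that by (auto simp: cube_def PiE_iff extensional_def space_PiM less_Suc_eq)
    then show ?thesis
      by (auto simp: indicator_def)
  qed
  have "integral_cube (Suc d) f =
      (\<integral>x. (\<integral>t. indicator (cube (Suc d)) (x(d := t)) *\<^sub>R f (x(d := t)) \<partial>lborel)
        \<partial>(\<Pi>\<^sub>M i\<in>{..<d}. lborel))"
    unfolding integral_cube_def set_lebesgue_integral_def lessThan_Suc
    using continuous_imp_integrable_cube[OF assms]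
    by (intro lborel_product.product_integral_insert) (auto simp: set_integrable_def lessThan_Suc)
  also have "\<dots> = (\<integral>x. indicator (cube d) x *\<^sub>R (LINT t:{0..1}|lborel. f (x(d := t)))
        \<partial>(\<Pi>\<^sub>M i\<in>{..<d}. lborel))"
    by (intro Bochner_Integration.integral_cong refl)
       (simp add: split set_lebesgue_integral_def mult.assoc)
  also have "\<dots> = integral_cube d (\<lambda>x. LINT t:{0..1}|lborel. f (x(d := t)))"
    by (simp add: integral_cube_def set_lebesgue_integral_def)
  also have "\<dots> = integral_cube d (\<lambda>x. integral {0..1} (\<lambda>t. f (x(d := t))))"
    by (intro integral_cube_cong set_lebesgue_integral_unit_interval
        continuous_on_cube_line_last[OF assms])
  finally show ?thesis .
qed

lemma integral_cube_0: "integral_cube 0 f = f (\<lambda>_. undefined)"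
proof -
  have "integral_cube 0 f = integral_cube 0 (\<lambda>_. f (\<lambda>_. undefined))"
    by (intro integral_cube_cong) (auto simp: cube_def)
  then show ?thesis
    by (simp add: integral_cube_const)
qed

lemma continuous_on_integral_last:
  fixes f :: "(nat \<Rightarrow> real) \<Rightarrow> real"
  assumes "continuous_on (cube (Suc d)) f"
  shows "continuous_on (cube d) (\<lambda>x. integral {0..1} (\<lambda>t. f (x(d := t)) :: real))"
proof -
  have "continuous_on (cube d \<times> cbox 0 1) (\<lambda>z. f ((fst z)(d := snd z)))"
    by (rule continuous_on_compose2[OF assms])
       (auto intro!: continuous_on_upd continuous_on_fst continuous_on_snd continuous_on_id cube_Suc_upd)
  then show ?thesis
    using integral_continuous_on_param[of "cube d" 0 1 "\<lambda>x t. f (x(d := t))"]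
    by (simp add: split_beta)
qed

lemma integral_cube_prod:
  assumes "\<And>i. i < d \<Longrightarrow> continuous_on {0..1} (g i :: real \<Rightarrow> real)"
  shows "integral_cube d (\<lambda>x. \<Prod>i<d. g i (x i)) = (\<Prod>i<d. integral {0..1} (g i))"
proof -
  have ind: "indicator (cube d) x = (\<Prod>i<d. indicator {0..1} (x i) :: real)"
    if x: "x \<in> space (\<Pi>\<^sub>M i\<in>{..<d}. (lborel :: real measure))" for x
  proof (cases "x \<in> cube d")
    case True
    then have "(\<Prod>i<d. indicator {0..1} (x i) :: real) = 1"
      by (intro prod.neutral ballI) (simp add: cube_component[unfolded atLeastAtMost_iff])
    then show ?thesis
      using True by simp
  next
    case False
    then obtain i where "i < d" "x i \<notin> {0..1}"
      using x by (auto simp: cube_def space_PiM PiE_iff)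
    then have "(\<Prod>i<d. indicator {0..1} (x i) :: real) = 0"
      by (intro prod_zero) (auto intro!: bexI[of _ i])
    then show ?thesis
      using False by simp
  qed
  have "integral_cube d (\<lambda>x. \<Prod>i<d. g i (x i)) =
      (\<integral>x. (\<Prod>i<d. indicator {0..1} (x i) *\<^sub>R g i (x i)) \<partial>(\<Pi>\<^sub>M i\<in>{..<d}. lborel))"
    unfolding integral_cube_def set_lebesgue_integral_def
    by (intro Bochner_Integration.integral_cong refl) (simp add: ind prod.distrib)
  also have "\<dots> = (\<Prod>i<d. \<integral>t. indicator {0..1} t *\<^sub>R g i t \<partial>lborel)"
    using borel_integrable_atLeastAtMost'[OF assms]
    by (intro lborel_product.product_integral_prod) (auto simp: set_integrable_def)
  also have "\<dots> = (\<Prod>i<d. integral {0..1} (g i))"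
    using set_lebesgue_integral_unit_interval[OF assms]
    by (intro prod.cong refl) (simp add: set_lebesgue_integral_def)
  finally show ?thesis .
qed

section \<open>Positive quadrature rules on the unit interval\<close>

lemma sum_div_mod:
  "(\<Sum>k<N * q. g (k div q) (k mod q)) = (\<Sum>c<N. \<Sum>i<q. g c i)" for q :: nat
proof -
  have "(\<Sum>k<N * q. g (k div q) (k mod q)) = (\<Sum>c<N. \<Sum>k\<in>{c * q..<c * q + q}. g (k div q) (k mod q))"
    by (rule sum.nat_group[symmetric])
  also have "\<dots> = (\<Sum>c<N. \<Sum>i<q. g c i)"
    using sum.shift_bounds_nat_ivl[of "\<lambda>k. g (k div q) (k mod q)" 0 "c * q" q for c]
    by (simp add: atLeast0LessThan add.commute)
  finally show ?thesis .
qed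

lemma poly_antiderivative: "\<exists>Q :: real poly. pderiv Q = p"
proof -
  have sum: "pderiv (\<Sum>i\<in>I. f i) = (\<Sum>i\<in>I. pderiv (f i))" for I :: "nat set" and f :: "nat \<Rightarrow> real poly"
    by (induction I rule: infinite_finite_induct) (auto simp: pderiv_add)
  have "pderiv (\<Sum>i\<le>degree p. monom (coeff p i / real (Suc i)) (Suc i)) = p"
    by (simp add: sum pderiv_monom poly_as_sum_of_monoms del: of_nat_Suc)
  then show ?thesis ..
qed

text \<open>
  In the Taylor expansions of an antiderivative \<open>Q\<close> at \<open>c + s\<close> and \<open>c - s\<close> all terms of even order
  cancel, so the midpoint value of \<open>Q'\<close> reproduces the increment of \<open>Q\<close> up to third order.
\<close>

lemma poly_midpoint_cell:
  fixes Q :: "real poly"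
  assumes "0 \<le> c - s" "c + s \<le> 1" "0 < s"
    and B: "\<And>t. t \<in> {0..1} \<Longrightarrow> \<bar>poly (pderiv (pderiv (pderiv Q))) t\<bar> \<le> B"
  shows "\<bar>poly Q (c + s) - poly Q (c - s) - 2 * s * poly (pderiv Q) c\<bar> \<le> B * s ^ 3"
proof -
  define diff where "diff m x = poly ((pderiv ^^ m) Q) x" for m x
  have der: "\<forall>m t. m < 3 \<and> a \<le> t \<and> t \<le> b \<longrightarrow> DERIV (diff m) t :> diff (Suc m) t" for a b
    by (simp add: diff_def[abs_def] poly_DERIV)
  have exp: "(\<Sum>m<3. diff m c / fact m * z ^ m) =
      poly Q c + poly (pderiv Q) c * z + poly (pderiv (pderiv Q)) c / 2 * z\<^sup>2" for z
    by (simp add: diff_def eval_nat_numeral)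
  have "\<exists>t1. c < t1 \<and> t1 < c + s \<and> poly Q (c + s) =
      (\<Sum>m<3. diff m c / fact m * (c + s - c) ^ m) + diff 3 t1 / fact 3 * (c + s - c) ^ 3"
    using assms by (intro Taylor_up[OF _ _ der, of _ _ c]) (auto simp: diff_def)
  then obtain t1 where "c < t1" "t1 < c + s" and t1: "poly Q (c + s) =
      (\<Sum>m<3. diff m c / fact m * s ^ m) + diff 3 t1 / fact 3 * s ^ 3"
    by auto
  then have t1_mem: "t1 \<in> {0..1}"
    using assms by auto
  have "\<exists>t2. c - s < t2 \<and> t2 < c \<and> poly Q (c - s) =
      (\<Sum>m<3. diff m c / fact m * (c - s - c) ^ m) + diff 3 t2 / fact 3 * (c - s - c) ^ 3"
    using assms by (intro Taylor_down[where b = c, OF _ _ der]) (auto simp: diff_def)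
  then obtain t2 where "c - s < t2" "t2 < c" and t2: "poly Q (c - s) =
      (\<Sum>m<3. diff m c / fact m * (- s) ^ m) + diff 3 t2 / fact 3 * (- s) ^ 3"
    by auto
  then have t2_mem: "t2 \<in> {0..1}"
    using assms by auto
  have eq: "poly Q (c + s) - poly Q (c - s) - 2 * s * poly (pderiv Q) c
      = (diff 3 t1 + diff 3 t2) / 6 * s ^ 3"
    unfolding t1 t2 exp by (simp add: field_simps fact_numeral)
  have "\<bar>diff 3 t1\<bar> \<le> B" "\<bar>diff 3 t2\<bar> \<le> B"
    using B[OF t1_mem] B[OF t2_mem] by (simp_all add: diff_def eval_nat_numeral)
  then have le: "\<bar>(diff 3 t1 + diff 3 t2) / 6\<bar> \<le> B"
    using abs_triangle_ineq[of "diff 3 t1" "diff 3 t2"] abs_ge_zero[of "diff 3 t1"]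
    unfolding abs_divide by simp
  have "\<bar>s ^ 3\<bar> = s ^ 3"
    using assms(3) by simp
  then show ?thesis
    unfolding eq abs_mult using le assms(3) by (simp only:) (intro mult_right_mono, auto)
qed

definition midpoint_sum :: "nat \<Rightarrow> (real \<Rightarrow> real) \<Rightarrow> real" where
  "midpoint_sum N g = (\<Sum>i<N. g ((2 * real i + 1) / (2 * real N))) / real N"

text \<open>
  The rate \<open>1 / N\<^sup>2\<close> matters: it is of smaller order than the weight \<open>1 / N\<close> of a single node, so
  the rule can later be corrected without making any weight negative.
\<close>

lemma midpoint_rule_error:
  "\<exists>B\<ge>0. \<forall>N\<ge>1. \<bar>integral {0..1} (poly p) - midpoint_sum N (poly p)\<bar> \<le> B / (real N)\<^sup>2"
proof -
  obtain Q where Q: "pderiv Q = p"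
    using poly_antiderivative by blast
  have "bounded (poly (pderiv (pderiv p)) ` {0..1})"
    by (intro compact_imp_bounded compact_continuous_image continuous_intros) auto
  then obtain B where B: "\<And>t. t \<in> {0..1} \<Longrightarrow> \<bar>poly (pderiv (pderiv p)) t\<bar> \<le> B"
    by (metis (no_types) bounded_iff imageI real_norm_def)
  have "B \<ge> 0"
    using B[of 0] by auto
  moreover have "\<bar>integral {0..1} (poly p) - midpoint_sum N (poly p)\<bar> \<le> B / (real N)\<^sup>2"
    if "N \<ge> 1" for N
  proof -
    define s where "s = 1 / (2 * real N)"
    define c where "c i = (2 * real i + 1) / (2 * real N)" for i
    define E where "E i = poly Q (c i + s) - poly Q (c i - s) - 2 * s * poly p (c i)" for i
    have "(poly p has_integral poly Q 1 - poly Q 0) {0..1}"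
      by (intro fundamental_theorem_of_calculus)
         (auto simp: has_real_derivative_iff_has_vector_derivative[symmetric] Q[symmetric]
           intro: poly_DERIV DERIV_subset)
    then have "integral {0..1} (poly p) = poly Q 1 - poly Q 0"
      by (rule integral_unique)
    also have "\<dots> = (\<Sum>i<N. poly Q (real (Suc i) / real N) - poly Q (real i / real N))"
      using that by (subst sum_lessThan_telescope) simp
    also have "\<dots> = (\<Sum>i<N. E i) + midpoint_sum N (poly p)"
    proof -
      have "real (Suc i) / real N = c i + s" "real i / real N = c i - s" for i
        using that by (simp_all add: c_def s_def field_simps)
      then show ?thesis
        by (simp add: E_def sum_subtractf midpoint_sum_def sum_distrib_left sum_divide_distrib
            s_def c_def)
    qed
    finally have "\<bar>integral {0..1} (poly p) - midpoint_sum N (poly p)\<bar> \<le> (\<Sum>i<N. \<bar>E i\<bar>)"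
      by simp
    also have "\<dots> \<le> (\<Sum>i<N. B * s ^ 3)"
    proof (rule sum_mono)
      fix i assume i: "i \<in> {..<N}"
      then have "real i + 1 \<le> real N"
        by simp
      then show "\<bar>E i\<bar> \<le> B * s ^ 3"
        unfolding E_def Q[symmetric] using that
        by (intro poly_midpoint_cell B[folded Q]) (auto simp: c_def s_def field_simps)
    qed
    also have "\<dots> = B / (real N)\<^sup>2 / 8"
      using that by (simp add: s_def field_simps eval_nat_numeral)
    also have "\<dots> \<le> B / (real N)\<^sup>2"
      using divide_left_mono[of 1 8 "B / (real N)\<^sup>2"] \<open>B \<ge> 0\<close> by simp
    finally show ?thesis .
  qed
  ultimately show ?thesis
    by blast
qed

text \<open>
  The witnesses are the Lagrange basis polynomials of the nodes \<open>t\<close>.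
\<close>

lemma Lagrange_interpolation:
  fixes t :: "nat \<Rightarrow> real"
  assumes "inj_on t {..<r}"
  shows "\<exists>ell. \<forall>p. degree p < r \<longrightarrow> p = (\<Sum>l<r. smult (poly p (t l)) (ell l))"
proof -
  define ell where
    "ell l = (\<Prod>k\<in>{..<r} - {l}. smult (1 / (t l - t k)) [:- t k, 1:])" for l
  have val: "poly (ell l) (t k) = (if k = l then 1 else 0)" if "k < r" "l < r" for k l
  proof (cases "k = l")
    case True
    have "poly (ell l) (t l) = (\<Prod>k\<in>{..<r} - {l}. 1)"
      unfolding ell_def poly_prod
    proof (intro prod.cong refl)
      fix k assume "k \<in> {..<r} - {l}"
      then have "t l - t k \<noteq> 0"
        using inj_onD[OF assms, of l k] that by auto
      then show "poly (smult (1 / (t l - t k)) [:- t k, 1:]) (t l) = 1"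
        by (simp add: diff_divide_distrib[symmetric])
    qed
    then show ?thesis
      using True by simp
  next
    case False
    then show ?thesis
      using that by (auto simp: ell_def poly_prod intro!: prod_zero)
  qed
  have deg: "degree (ell l) < r" if "l < r" for l
  proof -
    have "degree (ell l) \<le> (\<Sum>k\<in>{..<r} - {l}. degree (smult (1 / (t l - t k)) [:- t k, 1:]))"
      unfolding ell_def by (rule order_trans[OF degree_prod_sum_le]) (auto simp: o_def)
    also have "\<dots> \<le> (\<Sum>k\<in>{..<r} - {l}. 1)"
      by (intro sum_mono order_trans[OF degree_smult_le]) auto
    also have "\<dots> < r"
      using that by simp
    finally show ?thesis .
  qed
  have "p = (\<Sum>l<r. smult (poly p (t l)) (ell l))" if "degree p < r" for p
  proof (rule poly_eqI_degree[of "t ` {..<r}"])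
    have "degree (\<Sum>l<r. smult (poly p (t l)) (ell l)) \<le> r - 1"
      using deg by (intro degree_sum_le order_trans[OF degree_smult_le]) force+
    then show "degree (\<Sum>l<r. smult (poly p (t l)) (ell l)) < card (t ` {..<r})"
      using that by (simp add: card_image[OF assms])
    show "degree p < card (t ` {..<r})"
      using that by (simp add: card_image[OF assms])
  next
    fix x assume "x \<in> t ` {..<r}"
    then obtain k where k: "k < r" "x = t k"
      by auto
    then have "(\<Sum>l<r. poly p (t l) * poly (ell l) (t k)) = (\<Sum>l<r. if l = k then poly p (t k) else 0)"
      by (intro sum.cong) (auto simp: val)
    then show "poly p x = poly (\<Sum>l<r. smult (poly p (t l)) (ell l)) x"
      using k by (simp add: poly_sum)
  qed
  then show ?thesis
    by blast
qed

text \<open>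
  Start from the midpoint rule with \<open>N\<close> nodes and add to it the functional
  \<open>p \<mapsto> \<Sum>\<^sub>l e\<^sub>l p(t\<^sub>l)\<close>, where \<open>t\<^sub>0, \<dots>, t\<^bsub>r-1\<^esub>\<close> are fixed points and \<open>e\<^sub>l\<close> is the midpoint error on
  the Lagrange polynomial of \<open>t\<^sub>l\<close>. By interpolation the sum is exact on all polynomials of degree
  less than \<open>r\<close>. Positivity comes from \<open>e\<^sub>l = O(1 / N\<^sup>2)\<close>, provided that each \<open>t\<^sub>l\<close> is itself a midpoint
  node and hence already carries the weight \<open>1 / N\<close>.
\<close>

lemma positive_quadrature_rule:
  assumes "r \<ge> 1"
  shows "\<exists>(q :: nat) \<xi> \<omega>. q \<ge> 1 \<and> (\<forall>i<q. \<xi> i \<in> {0..1 :: real} \<and> \<omega> i \<ge> (0 :: real)) \<and>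
    (\<forall>j<r. (\<Sum>i<q. \<omega> i * \<xi> i ^ j) = 1 / real (Suc j))"
proof -
  define t where "t l = (2 * real l + 1) / (2 * real r)" for l
  have "inj_on t {..<r}"
    using assms by (auto simp: t_def inj_on_def)
  then obtain ell where ell: "\<And>p. degree p < r \<Longrightarrow> p = (\<Sum>l<r. smult (poly p (t l)) (ell l))"
    using Lagrange_interpolation by blast
  define J where "J N p = integral {0..1} (poly p) - midpoint_sum N (poly p)" for N p
  have "\<exists>B. \<forall>l. B l \<ge> 0 \<and> (\<forall>N\<ge>1. \<bar>J N (ell l)\<bar> \<le> B l / (real N)\<^sup>2)"
    unfolding J_def using midpoint_rule_error by (intro choice) blast
  then obtain B where B: "\<And>l. B l \<ge> 0" "\<And>l N. N \<ge> 1 \<Longrightarrow> \<bar>J N (ell l)\<bar> \<le> B l / (real N)\<^sup>2"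
    by blast
  obtain p :: nat where p: "(\<Sum>l<r. B l) \<le> real p"
    using real_arch_simple by blast
  \<comment> \<open>The points \<open>t l\<close> are the midpoints of \<open>r\<close> cells. Dividing each cell into an odd number of
    parts keeps them midpoints, namely those with index \<open>pos l\<close> below.\<close>
  define N where "N = r * (2 * p + 1)"
  have "p \<le> 1 * (2 * p + 1)"
    by simp
  also have "\<dots> \<le> N"
    unfolding N_def using assms by (intro mult_right_mono) auto
  finally have pN: "p \<le> N" .
  have N: "N \<ge> 1"
    using assms by (simp add: N_def)
  define e where "e l = J N (ell l)" for l
  define \<xi> where "\<xi> i = (2 * real i + 1) / (2 * real N)" for i
  define pos where "pos l = l * (2 * p + 1) + p" for l
  define \<omega> where "\<omega> i = 1 / real N + (\<Sum>l<r. if i = pos l then e l else 0)" for i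
  have pos_less: "pos l < N" if "l < r" for l
  proof -
    have "pos l < Suc l * (2 * p + 1)"
      by (simp add: pos_def)
    also have "\<dots> \<le> N"
      unfolding N_def using that by (intro mult_right_mono) auto
    finally show ?thesis .
  qed
  have \<xi>_pos: "\<xi> (pos l) = t l" for l
  proof -
    have "2 * real (pos l) + 1 = (2 * real l + 1) * (2 * real p + 1)"
      "real N = real r * (2 * real p + 1)"
      by (simp_all add: pos_def N_def algebra_simps)
    then show ?thesis
      by (simp add: \<xi>_def t_def)
  qed
  have \<omega>_nonneg: "\<omega> i \<ge> 0" for i
  proof -
    have "\<bar>\<Sum>l<r. if i = pos l then e l else 0\<bar> \<le> (\<Sum>l<r. B l / (real N)\<^sup>2)"
    proof (rule order_trans[OF sum_abs sum_mono])
      fix l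
      show "\<bar>if i = pos l then e l else 0\<bar> \<le> B l / (real N)\<^sup>2"
        using B(1)[of l] B(2)[OF N, of l] by (auto simp: e_def)
    qed
    also have "\<dots> \<le> real N / (real N)\<^sup>2"
      unfolding sum_divide_distrib[symmetric] using p pN by (intro divide_right_mono) auto
    finally show ?thesis
      using N by (simp add: \<omega>_def power2_eq_square)
  qed
  have exact: "(\<Sum>i<N. \<omega> i * poly P (\<xi> i)) = integral {0..1} (poly P)" if "degree P < r" for P
  proof -
    have int: "poly P' integrable_on {0..1}" for P' :: "real poly"
      by (intro integrable_continuous_real continuous_intros)
    have "J N P = J N (\<Sum>l<r. smult (poly P (t l)) (ell l))"
      using ell[OF that] by simp
    also have "\<dots> = (\<Sum>l<r. poly P (t l) * e l)"
    proof -
      have "integral {0..1} (poly (\<Sum>l<r. smult (poly P (t l)) (ell l))) =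
          (\<Sum>l<r. poly P (t l) * integral {0..1} (poly (ell l)))"
        using int by (simp add: poly_sum[abs_def] integral_sum integrable_on_mult_right)
      moreover have "midpoint_sum N (poly (\<Sum>l<r. smult (poly P (t l)) (ell l))) =
          (\<Sum>l<r. poly P (t l) * midpoint_sum N (poly (ell l)))"
        by (simp add: midpoint_sum_def poly_sum sum_distrib_left sum_divide_distrib sum.swap[of _ "{..<N}"])
      ultimately show ?thesis
        by (simp add: J_def e_def sum_subtractf algebra_simps)
    qed
    finally have J: "J N P = (\<Sum>l<r. poly P (t l) * e l)" .
    have "(\<Sum>i<N. \<omega> i * poly P (\<xi> i)) = midpoint_sum N (poly P) +
        (\<Sum>i<N. \<Sum>l<r. (if i = pos l then e l else 0) * poly P (\<xi> i))"
      by (simp add: \<omega>_def distrib_right sum.distrib midpoint_sum_def \<xi>_def sum_divide_distrib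
          sum_distrib_right)
    also have "(\<Sum>i<N. \<Sum>l<r. (if i = pos l then e l else 0) * poly P (\<xi> i)) =
        (\<Sum>l<r. \<Sum>i<N. if i = pos l then e l * poly P (\<xi> i) else 0)"
      by (subst sum.swap) (intro sum.cong refl, simp)
    also have "\<dots> = (\<Sum>l<r. e l * poly P (t l))"
      by (intro sum.cong refl) (simp add: \<xi>_pos pos_less)
    finally show ?thesis
      using J by (simp add: J_def mult.commute)
  qed
  have "(\<Sum>i<N. \<omega> i * \<xi> i ^ j) = 1 / real (Suc j)" if "j < r" for j
  proof -
    have "integral {0..1} (\<lambda>x :: real. x ^ j) = (LINT x:{0..1}|lborel. x ^ j)"
      by (intro set_lebesgue_integral_unit_interval[symmetric] continuous_intros)
    also have "\<dots> = 1 / real (Suc j)"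
      using integral_power[of 0 1 j] by (simp add: set_lebesgue_integral_def mult.commute)
    finally have "integral {0..1} (\<lambda>x :: real. x ^ j) = 1 / real (Suc j)" .
    moreover have "degree (monom (1 :: real) j) < r"
      using that by (simp add: degree_monom_eq)
    ultimately show ?thesis
      using exact[of "monom 1 j"] by (simp add: poly_monom[abs_def])
  qed
  moreover have "\<xi> i \<in> {0..1}" if "i < N" for i
    using that by (simp add: \<xi>_def field_simps)
  ultimately show ?thesis
    using N \<omega>_nonneg by (intro exI[of _ N] exI[of _ \<xi>] exI[of _ \<omega>]) simp
qed

text \<open>
  \<open>D m\<close> stands for the derivative of order \<open>m\<close> of the function \<open>D 0\<close> on the unit interval,
  one-sided at the end points. It will be instantiated with the restrictions of a function on the
  cube to lines parallel to the axes.
\<close>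

locale smooth_line =
  fixes r :: nat and D :: "nat \<Rightarrow> real \<Rightarrow> real"
  assumes derivs: "\<And>m t. m < r \<Longrightarrow> t \<in> {0..1} \<Longrightarrow>
      (D m has_vector_derivative D (Suc m) t) (at t within {0..1})"
    and bound: "\<And>t. t \<in> {0..1} \<Longrightarrow> \<bar>D r t\<bar> \<le> 1"
    and order_pos: "r \<ge> 1"
begin

text \<open>
  The Taylor polynomial of degree less than \<open>r\<close>. Expanding about the left end point of a cell needs
  only derivatives within the unit interval.
\<close>

definition taylor :: "real \<Rightarrow> real \<Rightarrow> real" where
  "taylor a t = (\<Sum>k<r. (t - a) ^ k / fact k * D k a)"

lemma continuous: "continuous_on {0..1} (D 0)"
  unfolding continuous_on_eq_continuous_within
  by (intro ballI has_vector_derivative_continuous[OF derivs]) (use order_pos in auto)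

lemma taylor_error:
  assumes "0 \<le> a" "a \<le> t" "t \<le> 1"
  shows "\<bar>D 0 t - taylor a t\<bar> \<le> (t - a) ^ r"
proof -
  have "((\<lambda>x. ((t - x) ^ (r - 1) / fact (r - 1)) *\<^sub>R D r x) has_integral
      D 0 t - (\<Sum>i<r. ((t - a) ^ i / fact i) *\<^sub>R D i a)) {a..t}"
    using assms order_pos
    by (intro Taylor_has_integral has_vector_derivative_within_subset[OF derivs]) auto
  then have int: "((\<lambda>x. (t - x) ^ (r - 1) / fact (r - 1) * D r x) has_integral D 0 t - taylor a t) {a..t}"
    by (simp add: taylor_def)
  have "norm (D 0 t - taylor a t) \<le> (t - a) ^ (r - 1) * measure lborel {a..t}"
  proof (rule has_integral_bound_real[OF _ finite.emptyI])
    show "((\<lambda>x. (t - x) ^ (r - 1) / fact (r - 1) * D r x) has_integral D 0 t - taylor a t) {a..t}"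
      by (fact int)
    fix x assume x: "x \<in> {a..t} - {}"
    have "(t - x) ^ (r - 1) / fact (r - 1) \<le> (t - x) ^ (r - 1) / 1"
      using x by (intro divide_left_mono) (auto simp: fact_ge_1)
    also have "\<dots> \<le> (t - a) ^ (r - 1)"
      using x by (auto intro!: power_mono)
    finally have "(t - x) ^ (r - 1) / fact (r - 1) * \<bar>D r x\<bar> \<le> (t - a) ^ (r - 1) * 1"
      using x assms by (intro mult_mono bound) auto
    then show "norm ((t - x) ^ (r - 1) / fact (r - 1) * D r x) \<le> (t - a) ^ (r - 1)"
      using x by (simp add: abs_mult)
  qed (use assms in auto)
  also have "\<dots> = (t - a) ^ r"
    using assms order_pos by (simp add: power_eq_if[of _ r])
  finally show ?thesis
    by simp
qed

lemma integral_taylor: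
  assumes "0 \<le> h"
  shows "(taylor a has_integral (\<Sum>k<r. h ^ Suc k / real (Suc k) / fact k * D k a)) {a..a + h}"
proof -
  have "((\<lambda>t. (t - a) ^ k) has_integral
      ((a + h - a) ^ Suc k / real (Suc k) - (a - a) ^ Suc k / real (Suc k))) {a..a + h}" for k
  proof (intro fundamental_theorem_of_calculus)
    fix x
    have "((\<lambda>t. (t - a) ^ Suc k / real (Suc k)) has_real_derivative
        real (Suc k) * (x - a) ^ k / real (Suc k)) (at x within {a..a + h})"
      by (rule DERIV_cdivide, (auto intro!: derivative_eq_intros)[1], cases k, auto simp: algebra_simps)
    then show "((\<lambda>t. (t - a) ^ Suc k / real (Suc k)) has_vector_derivative (x - a) ^ k)
        (at x within {a..a + h})"
      by (simp add: has_real_derivative_iff_has_vector_derivative del: power_Suc of_nat_Suc)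
  qed (use assms in auto)
  then have "((\<lambda>t. (t - a) ^ k / fact k * D k a) has_integral
      h ^ Suc k / real (Suc k) / fact k * D k a) {a..a + h}" for k
    by (intro has_integral_mult_left has_integral_divide) simp
  then show ?thesis
    unfolding taylor_def[abs_def] by (intro has_integral_sum) auto
qed

text \<open>
  A rule that is exact in degree less than \<open>r\<close>, transported to a cell of length \<open>h\<close>, integrates the
  Taylor polynomial exactly. Only the remainder, of size \<open>h ^ r\<close>, contributes: once through the
  integral and once through the rule, whose weights are nonnegative with sum 1.
\<close>

lemma quadrature_cell_error:
  assumes \<xi>: "\<And>i. i < q \<Longrightarrow> \<xi> i \<in> {0..1}" and \<omega>: "\<And>i. i < q \<Longrightarrow> \<omega> i \<ge> 0"
    and exact: "\<And>j. j < r \<Longrightarrow> (\<Sum>i<q. \<omega> i * \<xi> i ^ j) = 1 / real (Suc j)"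
    and a: "0 \<le> a" "0 \<le> h" "a + h \<le> 1"
  shows "\<bar>integral {a..a + h} (D 0) - h * (\<Sum>i<q. \<omega> i * D 0 (a + h * \<xi> i))\<bar> \<le> 2 * h ^ Suc r"
proof -
  have int: "D 0 integrable_on {a..a + h}"
    using a by (intro integrable_continuous_real continuous_on_subset[OF continuous]) auto
  have "((\<lambda>t. D 0 t - taylor a t) has_integral
      integral {a..a + h} (D 0) - integral {a..a + h} (taylor a)) {a..a + h}"
    using integral_taylor[OF a(2), of a] int by (intro has_integral_diff) auto
  then have "norm (integral {a..a + h} (D 0) - integral {a..a + h} (taylor a)) \<le>
      h ^ r * measure lborel {a..a + h}"
  proof (rule has_integral_bound_real[OF _ finite.emptyI, rotated])
    fix t assume t: "t \<in> {a..a + h} - {}"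
    then have "\<bar>D 0 t - taylor a t\<bar> \<le> (t - a) ^ r"
      using a by (intro taylor_error) auto
    also have "\<dots> \<le> h ^ r"
      using t by (intro power_mono) auto
    finally show "norm (D 0 t - taylor a t) \<le> h ^ r"
      by simp
  qed (use a in auto)
  then have 1: "\<bar>integral {a..a + h} (D 0) - integral {a..a + h} (taylor a)\<bar> \<le> h ^ Suc r"
    using a by (simp add: mult.commute)
  have "h * (\<Sum>i<q. \<omega> i * taylor a (a + h * \<xi> i)) =
      (\<Sum>i<q. \<Sum>k<r. h ^ Suc k / fact k * D k a * (\<omega> i * \<xi> i ^ k))"
    by (simp add: taylor_def sum_distrib_left power_mult_distrib mult_ac)
  also have "\<dots> = (\<Sum>k<r. h ^ Suc k / fact k * D k a * (\<Sum>i<q. \<omega> i * \<xi> i ^ k))"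
    by (subst sum.swap) (simp add: sum_distrib_left)
  also have "\<dots> = (\<Sum>k<r. h ^ Suc k / real (Suc k) / fact k * D k a)"
    by (intro sum.cong refl) (simp add: exact del: of_nat_Suc)
  also have "\<dots> = integral {a..a + h} (taylor a)"
    by (rule integral_unique[OF integral_taylor[OF a(2)], symmetric])
  finally have 2: "integral {a..a + h} (taylor a) - h * (\<Sum>i<q. \<omega> i * D 0 (a + h * \<xi> i)) =
      h * (\<Sum>i<q. \<omega> i * (taylor a (a + h * \<xi> i) - D 0 (a + h * \<xi> i)))"
    by (simp add: sum_subtractf algebra_simps)
  have "\<bar>\<Sum>i<q. \<omega> i * (taylor a (a + h * \<xi> i) - D 0 (a + h * \<xi> i))\<bar> \<le> (\<Sum>i<q. \<omega> i * h ^ r)"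
  proof (rule order_trans[OF sum_abs sum_mono])
    fix i assume i: "i \<in> {..<q}"
    then have \<xi>i: "0 \<le> \<xi> i" "\<xi> i \<le> 1"
      using \<xi> by auto
    then have h\<xi>: "h * \<xi> i \<le> h"
      using a mult_left_mono[of "\<xi> i" 1 h] by simp
    have "\<bar>D 0 (a + h * \<xi> i) - taylor a (a + h * \<xi> i)\<bar> \<le> (a + h * \<xi> i - a) ^ r"
      using \<xi>i h\<xi> a by (intro taylor_error) auto
    also have "\<dots> \<le> h ^ r"
      using \<xi>i h\<xi> a by (intro power_mono) auto
    finally show "\<bar>\<omega> i * (taylor a (a + h * \<xi> i) - D 0 (a + h * \<xi> i))\<bar> \<le> \<omega> i * h ^ r"
      using \<omega> i by (simp add: abs_mult abs_minus_commute mult_left_mono)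
  qed
  also have "\<dots> = h ^ r"
    using exact[of 0] order_pos by (simp add: sum_distrib_right[symmetric])
  finally have "\<bar>integral {a..a + h} (taylor a) - h * (\<Sum>i<q. \<omega> i * D 0 (a + h * \<xi> i))\<bar> \<le> h ^ Suc r"
    unfolding 2 using a by (simp add: abs_mult mult_left_mono)
  with 1 show ?thesis
    by linarith
qed

lemma composite_quadrature_error:
  assumes \<xi>: "\<And>i. i < q \<Longrightarrow> \<xi> i \<in> {0..1}" and \<omega>: "\<And>i. i < q \<Longrightarrow> \<omega> i \<ge> 0"
    and exact: "\<And>j. j < r \<Longrightarrow> (\<Sum>i<q. \<omega> i * \<xi> i ^ j) = 1 / real (Suc j)"
    and N: "N \<ge> 1"
  shows "\<bar>integral {0..1} (D 0) - (\<Sum>c<N. \<Sum>i<q. \<omega> i / real N * D 0 ((real c + \<xi> i) / real N))\<bar>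
    \<le> 2 * (1 / real N) ^ r"
proof -
  define h where "h = 1 / real N"
  define E where "E c = integral {real c * h..real c * h + h} (D 0)
      - h * (\<Sum>i<q. \<omega> i * D 0 (real c * h + h * \<xi> i))" for c
  have split: "integral {0..real M * h} (D 0) = (\<Sum>c<M. integral {real c * h..real c * h + h} (D 0))"
    if "M \<le> N" for M
    using that
  proof (induction M)
    case (Suc M)
    have "real (Suc M) * h \<le> 1"
      using Suc.prems N by (simp add: h_def field_simps)
    then have "D 0 integrable_on {0..real (Suc M) * h}"
      by (intro integrable_continuous_real continuous_on_subset[OF continuous]) auto
    then have "integral {0..real (Suc M) * h} (D 0) =
        integral {0..real M * h} (D 0) + integral {real M * h..real (Suc M) * h} (D 0)"
      by (intro Henstock_Kurzweil_Integration.integral_combine[symmetric]) (auto simp: h_def divide_right_mono)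
    then show ?case
      using Suc by (simp add: algebra_simps)
  qed simp
  have "integral {0..1} (D 0) - (\<Sum>c<N. \<Sum>i<q. \<omega> i / real N * D 0 ((real c + \<xi> i) / real N)) = (\<Sum>c<N. E c)"
    using split[of N] N
    by (simp add: h_def E_def sum_subtractf sum_distrib_left add_divide_distrib mult_ac)
  also have "\<bar>\<dots>\<bar> \<le> (\<Sum>c<N. 2 * h ^ Suc r)"
  proof (rule order_trans[OF sum_abs sum_mono])
    fix c assume "c \<in> {..<N}"
    then have "real c + 1 \<le> real N"
      by simp
    then have "real c * h + h \<le> 1"
      using N by (simp add: h_def field_simps)
    then show "\<bar>E c\<bar> \<le> 2 * h ^ Suc r"
      unfolding E_def by (intro quadrature_cell_error assms) (auto simp: h_def)
  qed
  also have "\<dots> = 2 * h ^ r"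
    using N by (simp add: h_def)
  finally show ?thesis
    by (simp add: h_def)
qed

end

text \<open>
  The exact rule with \<open>q\<close> nodes is repeated on \<open>m div q\<close> equal cells. Nonnegative weights with sum 1
  are essential for the passage to high dimension: the product of such rules has norm 1 in every
  dimension.
\<close>

lemma positive_quadrature_unit_interval:
  assumes "r \<ge> 1"
  shows "\<exists>q\<ge>1. \<forall>m\<ge>q. \<exists>\<xi> \<omega>. (\<forall>k<m. \<xi> k \<in> {0..1} \<and> 0 \<le> \<omega> k) \<and> (\<Sum>k<m. \<omega> k) = 1 \<and>
    (\<forall>D. smooth_line r D \<longrightarrow>
      \<bar>integral {0..1} (D 0) - (\<Sum>k<m. \<omega> k * D 0 (\<xi> k))\<bar> \<le> 2 * (2 * real q / real m) ^ r)"
proof -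
  obtain q :: nat and \<xi> \<omega> where q: "q \<ge> 1" and \<xi>: "\<And>i. i < q \<Longrightarrow> \<xi> i \<in> {0..1 :: real}"
    and \<omega>: "\<And>i. i < q \<Longrightarrow> \<omega> i \<ge> (0 :: real)"
    and exact: "\<And>j. j < r \<Longrightarrow> (\<Sum>i<q. \<omega> i * \<xi> i ^ j) = 1 / real (Suc j)"
    using positive_quadrature_rule[OF assms] by blast
  have "\<exists>\<xi> \<omega>. (\<forall>k<m. \<xi> k \<in> {0..1} \<and> 0 \<le> \<omega> k) \<and> (\<Sum>k<m. \<omega> k) = 1 \<and>
    (\<forall>D. smooth_line r D \<longrightarrow>
      \<bar>integral {0..1} (D 0) - (\<Sum>k<m. \<omega> k * D 0 (\<xi> k))\<bar> \<le> 2 * (2 * real q / real m) ^ r)"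
    if "m \<ge> q" for m
  proof -
    define N where "N = m div q"
    have N: "N \<ge> 1"
      using that q by (simp add: N_def div_greater_zero_iff Suc_le_eq)
    have Nq: "N * q \<le> m"
      by (simp add: N_def)
    \<comment> \<open>The nodes left over when \<open>q\<close> does not divide \<open>m\<close> get the weight 0.\<close>
    define \<xi>' where "\<xi>' k = (if k < N * q then (real (k div q) + \<xi> (k mod q)) / real N else 0)" for k
    define \<omega>' where "\<omega>' k = (if k < N * q then \<omega> (k mod q) / real N else 0)" for k
    have sum: "(\<Sum>k<m. \<omega>' k * g (\<xi>' k)) =
        (\<Sum>c<N. \<Sum>i<q. \<omega> i / real N * g ((real c + \<xi> i) / real N))" for g :: "real \<Rightarrow> real"
    proof -
      have "(\<Sum>k<m. \<omega>' k * g (\<xi>' k)) = (\<Sum>k<N * q. \<omega>' k * g (\<xi>' k))"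
        using Nq by (intro sum.mono_neutral_right) (auto simp: \<omega>'_def)
      also have "\<dots> = (\<Sum>k<N * q. \<omega> (k mod q) / real N * g ((real (k div q) + \<xi> (k mod q)) / real N))"
        by (intro sum.cong) (auto simp: \<omega>'_def \<xi>'_def)
      finally show ?thesis
        using sum_div_mod[of "\<lambda>c i. \<omega> i / real N * g ((real c + \<xi> i) / real N)" q N] by simp
    qed
    have "\<xi>' k \<in> {0..1} \<and> 0 \<le> \<omega>' k" for k
    proof (cases "k < N * q")
      case True
      then have "k div q < N"
        by (simp add: less_mult_imp_div_less)
      then have "real (k div q) + 1 \<le> real N"
        by simp
      then show ?thesis
        using True \<xi>[of "k mod q"] \<omega>[of "k mod q"] q N
        by (auto simp: \<xi>'_def \<omega>'_def field_simps)
    qed (auto simp: \<xi>'_def \<omega>'_def)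
    moreover have "(\<Sum>k<m. \<omega>' k) = 1"
      using sum[of "\<lambda>_. 1"] exact[of 0] assms N
      by (simp add: sum_divide_distrib[symmetric])
    moreover have "\<bar>integral {0..1} (D 0) - (\<Sum>k<m. \<omega>' k * D 0 (\<xi>' k))\<bar> \<le> 2 * (2 * real q / real m) ^ r"
      if D: "smooth_line r D" for D
    proof -
      have "m < q * N + q"
        unfolding N_def using q mult_div_mod_eq[of q m] mod_less_divisor[of q m] by linarith
      also have "\<dots> \<le> 2 * q * N"
        using N by simp
      finally have "real m \<le> real (2 * q * N)"
        by (intro of_nat_mono) simp
      then have "1 / real N \<le> 2 * real q / real m"
        using N q that \<open>m \<ge> q\<close> by (simp add: field_simps)
      then have "(1 / real N) ^ r \<le> (2 * real q / real m) ^ r"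
        by (intro power_mono) auto
      then show ?thesis
        using smooth_line.composite_quadrature_error[OF D, of q \<xi> \<omega> N] \<xi> \<omega> exact N
        unfolding sum by fastforce
    qed
    ultimately show ?thesis
      by blast
  qed
  with q show ?thesis
    by blast
qed

section \<open>Product rules\<close>

lemma cont_diff_imp_continuous: "cont_diff d r f \<Longrightarrow> continuous_on (cube d) f"
  by (cases r) auto

text \<open>
  The differentiability assumed at the point \<open>x(i := t)\<close> is differentiability of the same function of
  one variable at \<open>t\<close>, so a line parallel to an axis can be traversed with \<open>x\<close> fixed.
\<close>

lemma partial_deriv_works:
  assumes "cont_diff d (Suc k) f" "x \<in> cube d" "i < d" "t \<in> {0..1}"
  shows "((\<lambda>s. f (x(i := s))) has_vector_derivative partial_deriv i f (x(i := t)))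
    (at t within {0..1})"
proof -
  have "\<forall>y\<in>cube d. (\<lambda>s. f (y(i := s))) differentiable (at (y i) within {0..1})"
    using assms(1,3) by simp
  from bspec[OF this cube_upd[OF assms(2-4)]] show ?thesis
    by (simp add: partial_deriv_def vector_derivative_works[symmetric])
qed

lemma cont_diff_funpow_partial_deriv:
  assumes "cont_diff d k f" "i < d" "m \<le> k"
  shows "cont_diff d (k - m) ((partial_deriv i ^^ m) f)"
  using assms(3)
proof (induction m)
  case 0
  then show ?case
    using assms(1) by simp
next
  case (Suc m)
  then have "cont_diff d (Suc (k - Suc m)) ((partial_deriv i ^^ m) f)"
    by (simp add: Suc_diff_Suc)
  then show ?case
    using assms(2) by simp
qed

lemma multi_deriv_single:
  assumes "i < d"
  shows "multi_deriv d (\<lambda>j. if j = i then k else 0) f = (partial_deriv i ^^ k) f"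
proof -
  have "foldr (\<lambda>j. partial_deriv j ^^ (if j = i then k else 0)) js f =
      (if i \<in> set js then (partial_deriv i ^^ k) f else f)" if "distinct js" for js
    using that by (induction js) auto
  then show ?thesis
    using assms by (simp add: multi_deriv_def)
qed

lemma smooth_class_abs_le_1:
  assumes "f \<in> smooth_class r d" "x \<in> cube d"
  shows "\<bar>f x\<bar> \<le> 1"
proof -
  have "foldr (\<lambda>i. partial_deriv i ^^ 0) js f = f" for js
    by (induction js) auto
  then have "multi_deriv d (\<lambda>_. 0) f = f"
    by (simp add: multi_deriv_def)
  moreover have "\<bar>multi_deriv d (\<lambda>_. 0) f x\<bar> \<le> 1"
    using assms by (simp add: smooth_class_def)
  ultimately show ?thesis
    by simp
qed

lemma smooth_class_smooth_line:
  assumes f: "f \<in> smooth_class r d" and r: "r \<ge> 1" and x: "x \<in> cube d" "i < d"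
  shows "smooth_line r (\<lambda>m t. (partial_deriv i ^^ m) f (x(i := t)))"
proof
  fix m t assume m: "m < r" and t: "t \<in> {0..1 :: real}"
  have "cont_diff d (Suc (r - Suc m)) ((partial_deriv i ^^ m) f)"
    using cont_diff_funpow_partial_deriv[of d r f i m] f x m by (simp add: smooth_class_def Suc_diff_Suc)
  then show "((\<lambda>t. (partial_deriv i ^^ m) f (x(i := t))) has_vector_derivative
      (partial_deriv i ^^ Suc m) f (x(i := t))) (at t within {0..1})"
    using partial_deriv_works x t by fastforce
next
  fix t assume t: "t \<in> {0..1 :: real}"
  have "(\<Sum>j<d. if j = i then r else 0) \<le> r"
    using x by simp
  then have "\<bar>multi_deriv d (\<lambda>j. if j = i then r else 0) f (x(i := t))\<bar> \<le> 1"
    using f cube_upd[OF x t] by (auto simp: smooth_class_def)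
  then show "\<bar>(partial_deriv i ^^ r) f (x(i := t))\<bar> \<le> 1"
    by (simp add: multi_deriv_single x)
qed (fact r)

primrec product_rule ::
    "nat \<Rightarrow> (nat \<Rightarrow> real) \<Rightarrow> (nat \<Rightarrow> real) \<Rightarrow> nat \<Rightarrow> ((nat \<Rightarrow> real) \<Rightarrow> real) \<Rightarrow> real" where
  "product_rule m \<xi> \<omega> 0 f = f (\<lambda>_. undefined)"
| "product_rule m \<xi> \<omega> (Suc d) f = (\<Sum>k<m. \<omega> k * product_rule m \<xi> \<omega> d (\<lambda>x. f (x(d := \<xi> k))))"

text \<open>
  The one-dimensional errors add up. Integrate out the last coordinate: replacing that integral by
  the rule costs at most \<open>\<epsilon>\<close> at every point of the remaining cube, and what is left is a convex
  combination of \<open>d\<close>-dimensional problems of the same kind.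
\<close>

lemma product_rule_error:
  fixes f :: "(nat \<Rightarrow> real) \<Rightarrow> real"
  assumes \<xi>: "\<And>k. k < m \<Longrightarrow> \<xi> k \<in> {0..1}" and \<omega>: "\<And>k. k < m \<Longrightarrow> \<omega> k \<ge> 0"
    and total: "(\<Sum>k<m. \<omega> k) = 1"
    and "continuous_on (cube d) f"
    and "\<And>(x :: nat \<Rightarrow> real) i. x \<in> cube d \<Longrightarrow> i < d \<Longrightarrow>
      \<bar>integral {0..1} (\<lambda>t. f (x(i := t))) - (\<Sum>k<m. \<omega> k * f (x(i := \<xi> k)))\<bar> \<le> \<epsilon>"
  shows "\<bar>integral_cube d f - product_rule m \<xi> \<omega> d f\<bar> \<le> real d * \<epsilon>"
  using assms(4,5)
proof (induction d arbitrary: f)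
  case 0
  then show ?case
    by (simp add: integral_cube_0)
next
  case (Suc d)
  note cont = Suc.prems(1)
  have err: "\<bar>integral {0..1} (\<lambda>t. f (x(i := t))) - (\<Sum>k<m. \<omega> k * f (x(i := \<xi> k)))\<bar> \<le> \<epsilon>"
    if "x \<in> cube (Suc d)" "i < Suc d" for x i
    using that by (rule Suc.prems(2))
  define I where "I x = integral {0..1} (\<lambda>t. f (x(d := t)))" for x
  have I: "continuous_on (cube d) I"
    unfolding I_def by (rule continuous_on_integral_last[OF cont])
  have slice: "continuous_on (cube d) (\<lambda>x. f (x(d := \<xi> k)))" if "k < m" for k
    using that \<xi> by (intro continuous_on_cube_slice[OF cont])
  have sum_slices: "continuous_on (cube d) (\<lambda>x. \<Sum>k<m. \<omega> k * f (x(d := \<xi> k)))"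
    using slice by (intro continuous_intros) auto
  have "\<bar>integral_cube d (\<lambda>x. I x - (\<Sum>k<m. \<omega> k * f (x(d := \<xi> k))))\<bar> \<le> \<epsilon>"
  proof (rule abs_integral_cube_le)
    fix x assume "x \<in> cube d"
    then have "x(d := 0) \<in> cube (Suc d)"
      by (simp add: cube_Suc_upd)
    from err[OF this, of d, unfolded fun_upd_upd, OF lessI]
    show "\<bar>I x - (\<Sum>k<m. \<omega> k * f (x(d := \<xi> k)))\<bar> \<le> \<epsilon>"
      unfolding I_def .
  qed (intro continuous_intros I sum_slices)
  also have "integral_cube d (\<lambda>x. I x - (\<Sum>k<m. \<omega> k * f (x(d := \<xi> k)))) =
      integral_cube (Suc d) f - (\<Sum>k<m. \<omega> k * integral_cube d (\<lambda>x. f (x(d := \<xi> k))))"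
  proof -
    have "integral_cube d I = integral_cube (Suc d) f"
      unfolding I_def by (rule integral_cube_Suc[OF cont, symmetric])
    moreover have "integral_cube d (\<lambda>x. \<Sum>k<m. \<omega> k * f (x(d := \<xi> k))) =
        (\<Sum>k<m. \<omega> k * integral_cube d (\<lambda>x. f (x(d := \<xi> k))))"
      by (subst integral_cube_sum) (use slice in \<open>auto intro!: continuous_on_mult_left simp: integral_cube_cmult\<close>)
    ultimately show ?thesis
      using integral_cube_diff[OF I sum_slices] by simp
  qed
  finally have 1: "\<bar>integral_cube (Suc d) f -
      (\<Sum>k<m. \<omega> k * integral_cube d (\<lambda>x. f (x(d := \<xi> k))))\<bar> \<le> \<epsilon>" .
  have "\<bar>\<Sum>k<m. \<omega> k * (integral_cube d (\<lambda>x. f (x(d := \<xi> k))) - product_rule m \<xi> \<omega> d (\<lambda>x. f (x(d := \<xi> k))))\<bar>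
      \<le> (\<Sum>k<m. \<omega> k * (real d * \<epsilon>))"
  proof (rule order_trans[OF sum_abs sum_mono])
    fix k assume "k \<in> {..<m}"
    then have k: "k < m"
      by simp
    have "\<bar>integral_cube d (\<lambda>x. f (x(d := \<xi> k))) - product_rule m \<xi> \<omega> d (\<lambda>x. f (x(d := \<xi> k)))\<bar> \<le> real d * \<epsilon>"
    proof (rule Suc.IH[OF slice[OF k]])
      fix x i assume x: "x \<in> cube d" and i: "i < d"
      define y where "y = x(d := \<xi> k)"
      have y: "y \<in> cube (Suc d)"
        unfolding y_def by (rule cube_Suc_upd[OF x \<xi>[OF k]])
      have "x(i := t, d := \<xi> k) = y(i := t)" for t
        using i by (simp add: y_def fun_upd_twist)
      then show "\<bar>integral {0..1} (\<lambda>t. f (x(i := t, d := \<xi> k))) -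
          (\<Sum>l<m. \<omega> l * f (x(i := \<xi> l, d := \<xi> k)))\<bar> \<le> \<epsilon>"
        using err[OF y, of i] i by simp
    qed
    then show "\<bar>\<omega> k * (integral_cube d (\<lambda>x. f (x(d := \<xi> k))) - product_rule m \<xi> \<omega> d (\<lambda>x. f (x(d := \<xi> k))))\<bar>
        \<le> \<omega> k * (real d * \<epsilon>)"
      using \<omega>[OF k] by (simp add: abs_mult mult_left_mono)
  qed
  also have "\<dots> = real d * \<epsilon>"
    by (simp add: sum_distrib_right[symmetric] total)
  finally show ?case
    using 1 by (simp add: right_diff_distrib sum_subtractf algebra_simps)
qed

lemma product_rule_nodes:
  assumes \<xi>: "\<And>k. k < m \<Longrightarrow> \<xi> k \<in> {0..1}"
  shows "\<exists>P W. (\<forall>k < m ^ d. P k \<in> cube d) \<and>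
    (\<forall>f. product_rule m \<xi> \<omega> d f = (\<Sum>k<m ^ d. W k * f (P k)))"
proof (induction d)
  case 0
  show ?case
    by (rule exI[of _ "\<lambda>_ _. undefined"], rule exI[of _ "\<lambda>_. 1"]) (auto simp: cube_def)
next
  case (Suc d)
  then obtain P W where P: "\<And>k. k < m ^ d \<Longrightarrow> P k \<in> cube d"
    and W: "\<And>f. product_rule m \<xi> \<omega> d f = (\<Sum>k<m ^ d. W k * f (P k))"
    by blast
  define P' where "P' k = (P (k mod m ^ d))(d := \<xi> (k div m ^ d))" for k
  define W' where "W' k = \<omega> (k div m ^ d) * W (k mod m ^ d)" for k
  have "P' k \<in> cube (Suc d)" if "k < m ^ Suc d" for k
  proof -
    have "m > 0"
      using that by (cases m) auto
    moreover have "k div m ^ d < m"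
      using that by (simp add: less_mult_imp_div_less)
    ultimately show ?thesis
      unfolding P'_def by (intro cube_Suc_upd P \<xi>) auto
  qed
  moreover have "product_rule m \<xi> \<omega> (Suc d) f = (\<Sum>k<m ^ Suc d. W' k * f (P' k))" for f
    using sum_div_mod[of "\<lambda>c i. \<omega> c * W i * f ((P i)(d := \<xi> c))" "m ^ d" m]
    by (simp add: W P'_def W'_def sum_distrib_left mult.assoc)
  ultimately show ?case
    by blast
qed

lemma sample_values_nonadaptive:
  "sample_values (\<lambda>ys. P (length ys)) f n = map (\<lambda>k. f (P k)) [0..<n]"
  by (induction n) auto

text \<open>
  Sample points beyond the \<open>M\<close> that are used are placed at the origin.
\<close>

lemma linear_algorithm:
  fixes W :: "nat \<Rightarrow> real"
  assumes "\<And>k. k < M \<Longrightarrow> P k \<in> cube d" "M \<le> n"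
  shows "(\<lambda>f. \<Sum>k<M. W k * f (P k)) \<in> algorithms d n"
proof -
  define P' where "P' k = (if k < M then P k else (\<lambda>i\<in>{..<d}. 0))" for k
  have "P' k \<in> cube d" for k
    using assms(1) by (auto simp: P'_def cube_def)
  moreover have "(\<Sum>k<M. W k * f (P k)) = (\<Sum>k<M. W k * sample_values (\<lambda>ys. P' (length ys)) f n ! k)" for f
    unfolding sample_values_nonadaptive using assms(2)
    by (intro sum.cong) (auto simp: P'_def)
  ultimately show ?thesis
    unfolding algorithms_def
    by (intro CollectI exI[of _ "\<lambda>ys. P' (length ys)"] exI[of _ "\<lambda>ys. \<Sum>k<M. W k * ys ! k"]) auto
qed

lemma minimal_error_le:
  assumes "A \<in> algorithms d n"
    and "\<And>f. f \<in> smooth_class r d \<Longrightarrow> \<bar>integral_cube d f - A f\<bar> \<le> \<epsilon>"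
  shows "minimal_error r d n \<le> ereal \<epsilon>"
  unfolding minimal_error_def worst_case_error_def
  by (rule INF_lower2[OF assms(1)]) (use assms(2) in \<open>auto intro!: SUP_least\<close>)

text \<open>
  The zero algorithm already has error at most 1.
\<close>

lemma minimal_error_le_1: "minimal_error r d n \<le> 1"
proof -
  have "(\<lambda>_. 0) \<in> algorithms d n"
    using linear_algorithm[of 0 "\<lambda>_ _. 0" d n "\<lambda>_. 0"] by simp
  moreover have "\<bar>integral_cube d f - 0\<bar> \<le> 1" if "f \<in> smooth_class r d" for f
    using abs_integral_cube_le[of d f 1] smooth_class_abs_le_1[OF that] that
      cont_diff_imp_continuous[of d r f] by (simp add: smooth_class_def)
  ultimately show ?thesis
    using minimal_error_le[of "\<lambda>_. 0" d n r 1] by (simp add: one_ereal_def)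
qed

theorem minimal_error_upper_bound:
  assumes "r \<ge> 1"
  shows "\<exists>c>0. \<forall>d m n. m \<ge> 1 \<longrightarrow> d \<ge> 1 \<longrightarrow> m ^ d \<le> n \<longrightarrow>
    minimal_error r d n \<le> ereal (min 1 (c * real d * (1 / real m) ^ r))"
proof -
  obtain q :: nat where q: "q \<ge> 1" and rule: "\<And>m. m \<ge> q \<Longrightarrow>
    \<exists>\<xi> \<omega>. (\<forall>k<m. \<xi> k \<in> {0..1} \<and> 0 \<le> \<omega> k) \<and> (\<Sum>k<m. \<omega> k) = 1 \<and>
    (\<forall>D. smooth_line r D \<longrightarrow>
      \<bar>integral {0..1} (D 0) - (\<Sum>k<m. \<omega> k * D 0 (\<xi> k))\<bar> \<le> 2 * (2 * real q / real m) ^ r)"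
    using positive_quadrature_unit_interval[OF assms] by blast
  define c where "c = 2 * (2 * real q) ^ r"
  have c_eq: "2 * (2 * real q / real m) ^ r = c * (1 / real m) ^ r" for m
    by (simp add: c_def power_divide)
  \<comment> \<open>For \<open>m < q\<close> no composite rule is available, but then \<open>c\<close> is so large that the claimed bound
    exceeds the trivial bound 1.\<close>
  have bound: "minimal_error r d n \<le> ereal (c * real d * (1 / real m) ^ r)"
    if m: "m \<ge> 1" and d: "d \<ge> 1" and n: "m ^ d \<le> n" for d m n
  proof (cases "m \<ge> q")
    case True
    obtain \<xi> \<omega> where \<xi>: "\<And>k. k < m \<Longrightarrow> \<xi> k \<in> {0..1 :: real}" and \<omega>: "\<And>k. k < m \<Longrightarrow> 0 \<le> (\<omega> k :: real)"
      and total: "(\<Sum>k<m. \<omega> k) = 1"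
      and err: "\<And>D. smooth_line r D \<Longrightarrow>
        \<bar>integral {0..1} (D 0) - (\<Sum>k<m. \<omega> k * D 0 (\<xi> k))\<bar> \<le> c * (1 / real m) ^ r"
      using rule[OF True] unfolding c_eq by blast
    obtain P W where P: "\<And>k. k < m ^ d \<Longrightarrow> P k \<in> cube d"
      and W: "\<And>f. product_rule m \<xi> \<omega> d f = (\<Sum>k<m ^ d. W k * f (P k))"
      using product_rule_nodes[of m \<xi> d \<omega>] \<xi> by blast
    show ?thesis
    proof (rule minimal_error_le)
      show "product_rule m \<xi> \<omega> d \<in> algorithms d n"
        using linear_algorithm[OF P n, where W = W] by (simp add: W[abs_def])
      fix f assume f: "f \<in> smooth_class r d"
      have "\<bar>integral_cube d f - product_rule m \<xi> \<omega> d f\<bar> \<le> real d * (c * (1 / real m) ^ r)"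
      proof (rule product_rule_error[OF \<xi> \<omega> total])
        show "continuous_on (cube d) f"
          using f by (auto simp: smooth_class_def intro: cont_diff_imp_continuous)
        fix x i assume "x \<in> cube d" "i < d"
        from err[OF smooth_class_smooth_line[OF f assms this]]
        show "\<bar>integral {0..1} (\<lambda>t. f (x(i := t))) - (\<Sum>k<m. \<omega> k * f (x(i := \<xi> k)))\<bar> \<le> c * (1 / real m) ^ r"
          by simp
      qed
      then show "\<bar>integral_cube d f - product_rule m \<xi> \<omega> d f\<bar> \<le> c * real d * (1 / real m) ^ r"
        by (simp add: mult_ac)
    qed
  next
    case False
    have "(1 :: real) \<le> (2 * real q / real m) ^ r"
      using False m by (intro one_le_power) (simp add: field_simps)
    then have "1 * 1 \<le> real d * (c * (1 / real m) ^ r)"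
      using d unfolding c_eq[symmetric] by (intro mult_mono) auto
    then have "1 \<le> c * real d * (1 / real m) ^ r"
      by (simp add: mult_ac)
    then show ?thesis
      using minimal_error_le_1[of r d n] by (simp add: order_trans one_ereal_def)
  qed
  have "c > 0"
    using q by (simp add: c_def)
  then show ?thesis
    using bound minimal_error_le_1
    by (intro exI[of _ c]) (auto simp: min_def one_ereal_def)
qed

section \<open>Functions with bounded derivatives\<close>

definition has_partial ::
    "nat \<Rightarrow> nat \<Rightarrow> ((nat \<Rightarrow> real) \<Rightarrow> real) \<Rightarrow> ((nat \<Rightarrow> real) \<Rightarrow> real) \<Rightarrow> bool" where
  "has_partial d i f g \<longleftrightarrow>
    (\<forall>x\<in>cube d. ((\<lambda>t. f (x(i := t))) has_real_derivative g x) (at (x i) within {0..1}))"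

lemma has_partialD:
  "has_partial d i f g \<Longrightarrow> x \<in> cube d \<Longrightarrow>
    ((\<lambda>t. f (x(i := t))) has_real_derivative g x) (at (x i) within {0..1})"
  by (simp add: has_partial_def)

lemma has_partial_const: "has_partial d i (\<lambda>_. c) (\<lambda>_. 0)"
  by (simp add: has_partial_def)

lemma has_partial_add:
  assumes "has_partial d i f f'" "has_partial d i g g'"
  shows "has_partial d i (\<lambda>x. f x + g x) (\<lambda>x. f' x + g' x)"
  using assms unfolding has_partial_def by (intro ballI DERIV_add) auto

lemma has_partial_cmult:
  assumes "has_partial d i f f'"
  shows "has_partial d i (\<lambda>x. c * f x) (\<lambda>x. c * f' x)"
  using assms unfolding has_partial_def by (intro ballI DERIV_cmult) auto

lemma has_partial_mult:
  assumes "has_partial d i f f'" "has_partial d i g g'"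
  shows "has_partial d i (\<lambda>x. f x * g x) (\<lambda>x. f' x * g x + g' x * f x)"
  unfolding has_partial_def
proof
  fix x assume "x \<in> cube d"
  from DERIV_mult[OF has_partialD[OF assms(1) this] has_partialD[OF assms(2) this]]
  show "((\<lambda>t. f (x(i := t)) * g (x(i := t))) has_real_derivative f' x * g x + g' x * f x)
      (at (x i) within {0..1})"
    by simp
qed

lemma has_partial_sum:
  assumes "\<And>k. k \<in> K \<Longrightarrow> has_partial d i (f k) (f' k)"
  shows "has_partial d i (\<lambda>x. \<Sum>k\<in>K. f k x) (\<lambda>x. \<Sum>k\<in>K. f' k x)"
  using assms unfolding has_partial_def by (intro ballI DERIV_sum) auto

lemma has_partial_divide:
  assumes "has_partial d i f f'" "has_partial d i g g'" "\<And>x. x \<in> cube d \<Longrightarrow> g x \<noteq> 0"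
  shows "has_partial d i (\<lambda>x. f x / g x) (\<lambda>x. (f' x * g x - f x * g' x) / (g x * g x))"
  unfolding has_partial_def
proof
  fix x assume x: "x \<in> cube d"
  from DERIV_divide[OF has_partialD[OF assms(1) x] has_partialD[OF assms(2) x]] assms(3)[OF x]
  show "((\<lambda>t. f (x(i := t)) / g (x(i := t))) has_real_derivative
      (f' x * g x - f x * g' x) / (g x * g x)) (at (x i) within {0..1})"
    by simp
qed

lemma has_partial_compose:
  assumes "has_partial d i v v'"
    and "\<And>x. x \<in> cube d \<Longrightarrow> (g has_real_derivative g' (v x)) (at (v x))"
  shows "has_partial d i (\<lambda>x. g (v x)) (\<lambda>x. g' (v x) * v' x)"
  unfolding has_partial_def
proof
  fix x assume x: "x \<in> cube d"
  have "(g has_real_derivative g' (v x)) (at (v (x(i := x i))))"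
    using assms(2)[OF x] by simp
  from DERIV_chain2[OF this has_partialD[OF assms(1) x]]
  show "((\<lambda>t. g (v (x(i := t)))) has_real_derivative g' (v x) * v' x) (at (x i) within {0..1})" .
qed

lemma has_partial_cong:
  assumes "has_partial d i f f'" "\<And>x. x \<in> cube d \<Longrightarrow> f x = g x" "\<And>x. x \<in> cube d \<Longrightarrow> f' x = g' x" "i < d"
  shows "has_partial d i g g'"
  unfolding has_partial_def
proof
  fix x assume x: "x \<in> cube d"
  show "((\<lambda>t. g (x(i := t))) has_real_derivative g' x) (at (x i) within {0..1})"
  proof (rule has_field_derivative_transform_within[of _ _ _ _ 1])
    show "((\<lambda>t. f (x(i := t))) has_real_derivative g' x) (at (x i) within {0..1})"
      using has_partialD[OF assms(1) x] assms(3)[OF x] by simp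
    show "x i \<in> {0..1}"
      using cube_component[OF x assms(4)] .
    show "f (x(i := t)) = g (x(i := t))" if "t \<in> {0..1}" for t
      using assms(2)[OF cube_upd[OF x assms(4) that]] .
  qed simp
qed

lemma partial_deriv_eq:
  assumes "has_partial d i f g" "x \<in> cube d" "i < d"
  shows "partial_deriv i f x = g x"
  using has_partialD[OF assms(1,2)] cube_component[OF assms(2,3)]
  unfolding partial_deriv_def has_real_derivative_iff_has_vector_derivative
  by (intro vector_derivative_within_closed_interval) auto

text \<open>
  All mixed partial derivatives of order \<open>j \<le> k\<close> are bounded by \<open>K / \<delta> ^ j\<close>; here \<open>\<delta>\<close> is the length
  scale on which the function varies. The recursion mirrors the definition of the smoothness class.
  Existentially quantified partial derivatives are used because the values outside the cube are
  irrelevant.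
\<close>

primrec deriv_bound ::
    "nat \<Rightarrow> real \<Rightarrow> nat \<Rightarrow> real \<Rightarrow> ((nat \<Rightarrow> real) \<Rightarrow> real) \<Rightarrow> bool" where
  "deriv_bound d \<delta> 0 K f \<longleftrightarrow> continuous_on (cube d) f \<and> (\<forall>x\<in>cube d. \<bar>f x\<bar> \<le> K)"
| "deriv_bound d \<delta> (Suc k) K f \<longleftrightarrow> continuous_on (cube d) f \<and> (\<forall>x\<in>cube d. \<bar>f x\<bar> \<le> K) \<and>
    (\<forall>i<d. \<exists>g. has_partial d i f g \<and> deriv_bound d \<delta> k (K / \<delta>) g)"

lemma deriv_bound_continuous: "deriv_bound d \<delta> k K f \<Longrightarrow> continuous_on (cube d) f"
  by (cases k) auto

lemma deriv_bound_abs_le: "deriv_bound d \<delta> k K f \<Longrightarrow> x \<in> cube d \<Longrightarrow> \<bar>f x\<bar> \<le> K"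
  by (cases k) auto

lemma deriv_bound_SucE:
  assumes "deriv_bound d \<delta> (Suc k) K f" "i < d"
  obtains f' where "has_partial d i f f'" "deriv_bound d \<delta> k (K / \<delta>) f'"
proof -
  from assms have "\<exists>f'. has_partial d i f f' \<and> deriv_bound d \<delta> k (K / \<delta>) f'"
    by simp
  then show ?thesis
    using that by blast
qed

lemma deriv_bound_nonneg:
  assumes "deriv_bound d \<delta> k K f"
  shows "K \<ge> 0"
proof -
  have "(\<lambda>i\<in>{..<d}. 0) \<in> cube d"
    by (auto simp: cube_def)
  from deriv_bound_abs_le[OF assms this] show ?thesis
    by linarith
qed

lemma deriv_bound_mono:
  assumes "deriv_bound d \<delta> k K f" "K \<le> K'" "\<delta> > 0"
  shows "deriv_bound d \<delta> k K' f"
  using assms(1,2)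
proof (induction k arbitrary: f K K')
  case 0
  then show ?case
    by (auto intro: order_trans)
next
  case (Suc k)
  have "K / \<delta> \<le> K' / \<delta>"
    using Suc.prems(2) assms(3) by (simp add: divide_right_mono)
  then show ?case
    using Suc.prems Suc.IH by (fastforce intro: order_trans)
qed

lemma deriv_bound_SucD: "deriv_bound d \<delta> (Suc k) K f \<Longrightarrow> deriv_bound d \<delta> k K f"
proof (induction k arbitrary: f K)
  case (Suc k)
  then show ?case
    by (metis deriv_bound.simps(2))
qed auto

lemma deriv_bound_cong:
  assumes "deriv_bound d \<delta> k K f" "\<And>x. x \<in> cube d \<Longrightarrow> f x = g x"
  shows "deriv_bound d \<delta> k K g"
proof (cases k)
  case 0
  then show ?thesis
    using assms by (auto cong: continuous_on_cong)
next
  case (Suc l)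
  moreover have "continuous_on (cube d) g"
    using deriv_bound_continuous[OF assms(1)] assms(2) by (simp cong: continuous_on_cong)
  moreover have "\<exists>h. has_partial d i g h \<and> deriv_bound d \<delta> l (K / \<delta>) h" if i: "i < d" for i
  proof -
    obtain h where h: "has_partial d i f h" "deriv_bound d \<delta> l (K / \<delta>) h"
      using deriv_bound_SucE[OF assms(1)[unfolded Suc] i] .
    moreover have "has_partial d i g h"
      by (rule has_partial_cong[OF h(1) assms(2) refl i])
    ultimately show ?thesis
      by blast
  qed
  ultimately show ?thesis
    using deriv_bound_abs_le[OF assms(1)] assms(2) by auto
qed

lemma deriv_bound_const:
  assumes "\<bar>c\<bar> \<le> K" "\<delta> > 0"
  shows "deriv_bound d \<delta> k K (\<lambda>_. c)"
  using assms(1)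
proof (induction k arbitrary: c K)
  case (Suc k)
  then have "deriv_bound d \<delta> k (K / \<delta>) (\<lambda>_. 0)"
    using assms(2) by auto
  then show ?case
    using Suc.prems has_partial_const by (auto intro!: exI[of _ "\<lambda>_. 0"])
qed auto

lemma deriv_bound_add:
  assumes "deriv_bound d \<delta> k K f" "deriv_bound d \<delta> k K' g"
  shows "deriv_bound d \<delta> k (K + K') (\<lambda>x. f x + g x)"
  using assms
proof (induction k arbitrary: f g K K')
  case 0
  then show ?case
    by (auto intro!: continuous_intros order_trans[OF abs_triangle_ineq] add_mono)
next
  case (Suc k)
  have "\<exists>h. has_partial d i (\<lambda>x. f x + g x) h \<and> deriv_bound d \<delta> k ((K + K') / \<delta>) h" if i: "i < d" for i
  proof -
    obtain f' where "has_partial d i f f'" "deriv_bound d \<delta> k (K / \<delta>) f'"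
      using deriv_bound_SucE[OF Suc.prems(1) i] .
    moreover obtain g' where "has_partial d i g g'" "deriv_bound d \<delta> k (K' / \<delta>) g'"
      using deriv_bound_SucE[OF Suc.prems(2) i] .
    ultimately show ?thesis
      using has_partial_add Suc.IH by (fastforce simp: add_divide_distrib)
  qed
  then show ?case
    using Suc.prems
    by (auto intro!: continuous_intros order_trans[OF abs_triangle_ineq] add_mono)
qed

lemma deriv_bound_cmult:
  assumes "deriv_bound d \<delta> k K f"
  shows "deriv_bound d \<delta> k (\<bar>c\<bar> * K) (\<lambda>x. c * f x)"
  using assms
proof (induction k arbitrary: f K)
  case 0
  then show ?case
    by (auto intro!: continuous_intros simp: abs_mult mult_left_mono)
next
  case (Suc k)
  have "\<exists>h. has_partial d i (\<lambda>x. c * f x) h \<and> deriv_bound d \<delta> k (\<bar>c\<bar> * K / \<delta>) h" if i: "i < d" for i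
  proof -
    obtain f' where "has_partial d i f f'" "deriv_bound d \<delta> k (K / \<delta>) f'"
      using deriv_bound_SucE[OF Suc.prems i] .
    then show ?thesis
      using has_partial_cmult Suc.IH by fastforce
  qed
  then show ?case
    using Suc.prems by (auto intro!: continuous_intros simp: abs_mult mult_left_mono)
qed

text \<open>
  The factor \<open>2 ^ k\<close> is the sum of the binomial coefficients in Leibniz' rule. It is independent of
  the dimension.
\<close>

lemma deriv_bound_mult:
  assumes "deriv_bound d \<delta> k K f" "deriv_bound d \<delta> k K' g" "\<delta> > 0"
  shows "deriv_bound d \<delta> k (2 ^ k * K * K') (\<lambda>x. f x * g x)"
  using assms(1,2)
proof (induction k arbitrary: f g K K')
  case 0
  then have "K \<ge> 0" "K' \<ge> 0"
    using deriv_bound_nonneg by blast+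
  then show ?case
    using 0 by (auto intro!: continuous_intros simp: abs_mult mult_mono)
next
  case (Suc k)
  then have nonneg: "K \<ge> 0" "K' \<ge> 0"
    using deriv_bound_nonneg by blast+
  have "\<bar>f x * g x\<bar> \<le> 2 ^ Suc k * K * K'" if "x \<in> cube d" for x
  proof -
    have "\<bar>f x\<bar> * \<bar>g x\<bar> \<le> K * K'"
      using Suc.prems that nonneg by (intro mult_mono) auto
    also have "\<dots> \<le> 2 ^ Suc k * (K * K')"
      using nonneg mult_right_mono[of 1 "2 ^ Suc k" "K * K'"] one_le_power[of "2 :: real" "Suc k"]
      by simp
    finally show ?thesis
      by (simp add: abs_mult mult.assoc)
  qed
  moreover have "\<exists>h. has_partial d i (\<lambda>x. f x * g x) h \<and> deriv_bound d \<delta> k (2 ^ Suc k * K * K' / \<delta>) h"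
    if i: "i < d" for i
  proof -
    obtain f' where f': "has_partial d i f f'" "deriv_bound d \<delta> k (K / \<delta>) f'"
      using deriv_bound_SucE[OF Suc.prems(1) i] .
    obtain g' where g': "has_partial d i g g'" "deriv_bound d \<delta> k (K' / \<delta>) g'"
      using deriv_bound_SucE[OF Suc.prems(2) i] .
    have "deriv_bound d \<delta> k (2 ^ k * (K / \<delta>) * K' + 2 ^ k * (K' / \<delta>) * K) (\<lambda>x. f' x * g x + g' x * f x)"
      by (rule deriv_bound_add[OF Suc.IH[OF f'(2) deriv_bound_SucD[OF Suc.prems(2)]]
            Suc.IH[OF g'(2) deriv_bound_SucD[OF Suc.prems(1)]]])
    also have "2 ^ k * (K / \<delta>) * K' + 2 ^ k * (K' / \<delta>) * K = 2 ^ Suc k * K * K' / \<delta>"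
      by (simp add: field_simps)
    finally show ?thesis
      using has_partial_mult[OF f'(1) g'(1)] by blast
  qed
  moreover have "continuous_on (cube d) (\<lambda>x. f x * g x)"
    using Suc.prems by (auto intro!: continuous_intros)
  ultimately show ?case
    by simp
qed

text \<open>
  If the derivatives of the highest order \<open>k\<close> are at most 1, so are those of lower order, since
  \<open>\<delta> \<le> 1\<close>.
\<close>

lemma deriv_bound_rescale:
  assumes "deriv_bound d \<delta> k K f" "0 < \<delta>" "\<delta> \<le> 1" "K \<le> \<delta> ^ k"
  shows "deriv_bound d 1 k 1 f"
  using assms(1,4)
proof (induction k arbitrary: f K)
  case 0
  then have "\<bar>f x\<bar> \<le> 1" if "x \<in> cube d" for x
    using deriv_bound_abs_le[OF 0(1) that] by simp
  then show ?case
    using deriv_bound_continuous[OF 0(1)] by simp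
next
  case (Suc k)
  have "K / \<delta> \<le> \<delta> ^ k"
    using Suc.prems(2) assms(2) by (simp add: field_simps)
  note IH = Suc.IH[OF _ this]
  have "\<exists>g. has_partial d i f g \<and> deriv_bound d 1 k (1 / 1) g" if i: "i < d" for i
  proof -
    obtain g where "has_partial d i f g" "deriv_bound d \<delta> k (K / \<delta>) g"
      using deriv_bound_SucE[OF Suc.prems(1) i] .
    then show ?thesis
      using IH by auto
  qed
  moreover have "K \<le> 1"
    using Suc.prems(2) power_le_one[of \<delta> "Suc k"] assms by linarith
  then have "\<bar>f x\<bar> \<le> 1" if "x \<in> cube d" for x
    using deriv_bound_abs_le[OF Suc.prems(1) that] by linarith
  ultimately show ?case
    using deriv_bound_continuous[OF Suc.prems(1)] by simp
qed

lemma deriv_bound_partial_deriv: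
  assumes "deriv_bound d \<delta> (Suc k) K f" "i < d"
  shows "deriv_bound d \<delta> k (K / \<delta>) (partial_deriv i f)"
proof -
  obtain g where g: "has_partial d i f g" "deriv_bound d \<delta> k (K / \<delta>) g"
    using deriv_bound_SucE[OF assms] .
  show ?thesis
    by (rule deriv_bound_cong[OF g(2)]) (simp add: partial_deriv_eq[OF g(1) _ assms(2)])
qed

lemma deriv_bound_imp_cont_diff: "deriv_bound d \<delta> k K f \<Longrightarrow> cont_diff d k f"
proof (induction k arbitrary: f K)
  case (Suc k)
  have "(\<lambda>t. f (x(i := t))) differentiable at (x i) within {0..1}" if i: "i < d" and x: "x \<in> cube d" for i x
  proof -
    obtain f' where "has_partial d i f f'"
      using deriv_bound_SucE[OF Suc.prems i] .
    from has_partialD[OF this x] show ?thesis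
      unfolding real_differentiable_def by blast
  qed
  moreover have "cont_diff d k (partial_deriv i f)" if "i < d" for i
    by (rule Suc.IH[OF deriv_bound_partial_deriv[OF Suc.prems that]])
  ultimately show ?case
    using deriv_bound_continuous[OF Suc.prems] by simp
qed auto

lemma deriv_bound_imp_smooth_class:
  assumes "deriv_bound d 1 r 1 f"
  shows "f \<in> smooth_class r d"
proof -
  have pow: "deriv_bound d 1 (k - m) 1 ((partial_deriv i ^^ m) f)"
    if "deriv_bound d 1 k 1 f" "i < d" "m \<le> k" for k m i f
    using that(3)
  proof (induction m)
    case 0
    then show ?case
      using that by simp
  next
    case (Suc m)
    then have "deriv_bound d 1 (Suc (k - Suc m)) 1 ((partial_deriv i ^^ m) f)"
      by (simp add: Suc_diff_Suc)
    from deriv_bound_partial_deriv[OF this that(2)] show ?case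
      by simp
  qed
  have fold: "deriv_bound d 1 (r - sum_list (map \<beta> js)) 1 (foldr (\<lambda>i. partial_deriv i ^^ \<beta> i) js f)"
    if "sum_list (map \<beta> js) \<le> r" "\<forall>j\<in>set js. j < d" for \<beta> js
    using that
  proof (induction js)
    case Nil
    then show ?case
      using assms by simp
  next
    case (Cons j js)
    then have "deriv_bound d 1 (r - sum_list (map \<beta> js) - \<beta> j) 1
        ((partial_deriv j ^^ \<beta> j) (foldr (\<lambda>i. partial_deriv i ^^ \<beta> i) js f))"
      by (intro pow) auto
    then show ?case
      by (simp add: diff_diff_left add.commute)
  qed
  have "\<bar>multi_deriv d \<beta> f x\<bar> \<le> 1" if "(\<Sum>i<d. \<beta> i) \<le> r" "x \<in> cube d" for \<beta> x
    using fold[of \<beta> "[0..<d]"] that deriv_bound_abs_le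
    by (auto simp: multi_deriv_def interv_sum_list_conv_sum_set_nat atLeast0LessThan)
  then show ?thesis
    using deriv_bound_imp_cont_diff[OF assms] by (auto simp: smooth_class_def)
qed

section \<open>Composition with a bounded smooth function of one variable\<close>

primrec smooth_bounded :: "nat \<Rightarrow> real \<Rightarrow> (real \<Rightarrow> real) \<Rightarrow> bool" where
  "smooth_bounded 0 M g \<longleftrightarrow> continuous_on UNIV g \<and> (\<forall>s. \<bar>g s\<bar> \<le> M)"
| "smooth_bounded (Suc k) M g \<longleftrightarrow> continuous_on UNIV g \<and> (\<forall>s. \<bar>g s\<bar> \<le> M) \<and>
    (\<exists>g'. (\<forall>s. (g has_real_derivative g' s) (at s)) \<and> smooth_bounded k M g')"

lemma smooth_bounded_mono: "smooth_bounded k M g \<Longrightarrow> M \<le> M' \<Longrightarrow> smooth_bounded k M' g"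
  by (induction k arbitrary: g) (auto intro: order_trans)

lemma smooth_bounded_cmult: "smooth_bounded k M g \<Longrightarrow> smooth_bounded k (\<bar>c\<bar> * M) (\<lambda>s. c * g s)"
proof (induction k arbitrary: g)
  case 0
  then show ?case
    by (auto intro!: continuous_intros simp: abs_mult mult_left_mono)
next
  case (Suc k)
  then obtain g' where "\<forall>s. (g has_real_derivative g' s) (at s)" "smooth_bounded k M g'"
    by auto
  then have "(\<forall>s. ((\<lambda>s. c * g s) has_real_derivative c * g' s) (at s)) \<and>
      smooth_bounded k (\<bar>c\<bar> * M) (\<lambda>s. c * g' s)"
    using Suc.IH by (auto intro: DERIV_cmult)
  then show ?case
    using Suc.prems by (auto intro!: continuous_intros simp: abs_mult mult_left_mono)
qed

lemma smooth_bounded_diff: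
  "smooth_bounded k M g \<Longrightarrow> smooth_bounded k N h \<Longrightarrow> smooth_bounded k (M + N) (\<lambda>s. g s - h s)"
proof (induction k arbitrary: g h)
  case 0
  then show ?case
    by (auto intro!: continuous_intros order_trans[OF abs_triangle_ineq4] add_mono)
next
  case (Suc k)
  then obtain g' h' where "\<forall>s. (g has_real_derivative g' s) (at s)" "smooth_bounded k M g'"
    "\<forall>s. (h has_real_derivative h' s) (at s)" "smooth_bounded k N h'"
    by auto
  then have "(\<forall>s. ((\<lambda>s. g s - h s) has_real_derivative g' s - h' s) (at s)) \<and>
      smooth_bounded k (M + N) (\<lambda>s. g' s - h' s)"
    using Suc.IH by (auto intro: DERIV_diff)
  then show ?case
    using Suc.prems by (auto intro!: continuous_intros order_trans[OF abs_triangle_ineq4] add_mono)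
qed

text \<open>
  The form of the derivative is that of the powers of the hyperbolic tangent:
  \<open>(tanh\<^sup>j)' = j (tanh\<^bsup>j-1\<^esup> - tanh\<^bsup>j+1\<^esup>)\<close>. Powers of \<open>tanh\<close> are therefore closed under
  differentiation up to linear combinations, and they are all bounded by 1.
\<close>

lemma smooth_bounded_SucI:
  assumes "continuous_on UNIV g" "\<And>s. \<bar>g s\<bar> \<le> M"
    and "\<And>s. (g has_real_derivative c * (h s - h' s)) (at s)"
    and "\<exists>M. smooth_bounded k M h" "\<exists>M. smooth_bounded k M h'"
  shows "\<exists>M. smooth_bounded (Suc k) M g"
proof -
  obtain M1 M2 where "smooth_bounded k M1 h" "smooth_bounded k M2 h'"
    using assms by blast
  then have "smooth_bounded k (\<bar>c\<bar> * (M1 + M2)) (\<lambda>s. c * (h s - h' s))"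
    by (intro smooth_bounded_cmult smooth_bounded_diff)
  then have "smooth_bounded k (max M (\<bar>c\<bar> * (M1 + M2))) (\<lambda>s. c * (h s - h' s))"
    by (rule smooth_bounded_mono) simp
  then have "smooth_bounded (Suc k) (max M (\<bar>c\<bar> * (M1 + M2))) g"
    using assms(1-3) by (auto simp: le_max_iff_disj intro!: exI[of _ "\<lambda>s. c * (h s - h' s)"])
  then show ?thesis ..
qed

lemma abs_tanh_power_le_1: "\<bar>tanh (s :: real) ^ j\<bar> \<le> 1"
  using tanh_real_bounds[of s] unfolding power_abs by (intro power_le_one) auto

lemma DERIV_tanh_power:
  "((\<lambda>s :: real. tanh s ^ j) has_real_derivative real j * (tanh s ^ (j - 1) - tanh s ^ (j + 1))) (at s)"
proof (cases j)
  case (Suc l)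
  have "((\<lambda>s. tanh s ^ Suc l) has_real_derivative real (Suc l) * ((1 - tanh s ^ 2) * tanh s ^ l)) (at s)"
    by (auto intro!: derivative_eq_intros simp del: power_Suc)
  then show ?thesis
    by (simp add: Suc algebra_simps power2_eq_square)
qed simp

lemma smooth_bounded_tanh_power: "\<exists>M. smooth_bounded k M (\<lambda>s. tanh s ^ j)"
proof (induction k arbitrary: j)
  case 0
  show ?case
    using abs_tanh_power_le_1 by (intro exI[of _ 1]) (auto intro!: continuous_intros)
next
  case (Suc k)
  show ?case
    by (rule smooth_bounded_SucI[OF _ abs_tanh_power_le_1 DERIV_tanh_power Suc.IH Suc.IH])
       (auto intro!: continuous_intros)
qed

text \<open>
  A cutoff that vanishes on the negative half line, is bounded by 1 and tends to 1 at infinity. Its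
  powers obey the same differentiation rule as those of \<open>tanh\<close>; the kink at 0 only requires the
  exponent to exceed the order of differentiation.
\<close>

definition ramp :: "real \<Rightarrow> real" where
  "ramp s = tanh (max 0 s)"

lemma ramp_nonneg: "0 \<le> ramp s"
  by (simp add: ramp_def)

lemma abs_ramp_power_le_1: "\<bar>ramp s ^ j\<bar> \<le> 1"
  unfolding ramp_def by (rule abs_tanh_power_le_1)

lemma DERIV_ramp_power:
  assumes "j \<ge> 2"
  shows "((\<lambda>s. ramp s ^ j) has_real_derivative real j * (ramp s ^ (j - 1) - ramp s ^ (j + 1))) (at s)"
proof -
  consider "s > 0" | "s < 0" | "s = 0"
    by linarith
  then show ?thesis
  proof cases
    case 1
    have "((\<lambda>s. ramp s ^ j) has_real_derivative real j * (tanh s ^ (j - 1) - tanh s ^ (j + 1))) (at s)"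
      by (rule has_field_derivative_transform_within_open[OF DERIV_tanh_power, of "{0<..}"])
         (use 1 in \<open>auto simp: ramp_def\<close>)
    then show ?thesis
      using 1 by (simp add: ramp_def)
  next
    case 2
    have "((\<lambda>s. ramp s ^ j) has_real_derivative 0) (at s)"
      by (rule has_field_derivative_transform_within_open[OF DERIV_const[of 0], of "{..<0}"])
         (use 2 assms in \<open>auto simp: ramp_def\<close>)
    then show ?thesis
      using 2 assms by (simp add: ramp_def power_0_left)
  next
    case 3
    \<comment> \<open>At the kink, the difference quotients are dominated by those of \<open>tanh ^ j\<close>, which has a
      critical point there.\<close>
    have "((\<lambda>s :: real. tanh s ^ j) has_real_derivative 0) (at 0)"
      using DERIV_tanh_power[of j 0] assms by (simp add: power_0_left)
    then have lim: "((\<lambda>h :: real. tanh h ^ j / h) \<longlongrightarrow> 0) (at 0)"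
      using assms by (simp add: DERIV_def power_0_left)
    have "((\<lambda>h. ramp h ^ j / h) \<longlongrightarrow> 0) (at 0)"
    proof (rule Lim_null_comparison[OF _ tendsto_norm_zero[OF lim]])
      have "norm (ramp h ^ j / h) \<le> norm (tanh h ^ j / h)" for h
        using assms by (cases "h \<ge> 0") (auto simp: ramp_def power_0_left divide_nonneg_nonpos)
      then show "\<forall>\<^sub>F h in at 0. norm (ramp h ^ j / h) \<le> norm (tanh h ^ j / h)"
        by simp
    qed
    then show ?thesis
      using 3 assms by (simp add: DERIV_def ramp_def power_0_left)
  qed
qed

lemma smooth_bounded_ramp_power:
  assumes "j \<ge> k + 1"
  shows "\<exists>M. smooth_bounded k M (\<lambda>s. ramp s ^ j)"
  using assms
proof (induction k arbitrary: j)
  case 0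
  show ?case
    using abs_ramp_power_le_1 by (intro exI[of _ 1]) (auto intro!: continuous_intros simp: ramp_def[abs_def])
next
  case (Suc k)
  show ?case
  proof (rule smooth_bounded_SucI[OF _ abs_ramp_power_le_1 DERIV_ramp_power Suc.IH Suc.IH])
    show "continuous_on UNIV (\<lambda>s. ramp s ^ j)"
      by (auto intro!: continuous_intros simp: ramp_def[abs_def])
  qed (use Suc.prems in auto)
qed

text \<open>
  The constant in the chain rule below. Each differentiation produces a single product
  \<open>g'(v) \<cdot> \<partial>\<^sub>i v\<close>, so the dimension does not enter.
\<close>

primrec comp_const :: "real \<Rightarrow> real \<Rightarrow> nat \<Rightarrow> real" where
  "comp_const M K 0 = M"
| "comp_const M K (Suc k) = max M (2 ^ k * comp_const M K k * K)"

lemma deriv_bound_compose: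
  assumes "smooth_bounded k M g" and v: "continuous_on (cube d) v" and \<delta>: "\<delta> > 0"
    and v': "\<And>i. i < d \<Longrightarrow> \<exists>v'. has_partial d i v v' \<and> deriv_bound d \<delta> k (K / \<delta>) v'"
  shows "deriv_bound d \<delta> k (comp_const M K k) (\<lambda>x. g (v x))"
  using assms(1) v'
proof (induction k arbitrary: g)
  case 0
  then show ?case
    by (auto intro: continuous_on_compose2[OF _ v])
next
  case (Suc k)
  then obtain g' where g': "\<And>s. (g has_real_derivative g' s) (at s)" "smooth_bounded k M g'"
    by auto
  have "\<exists>h. has_partial d i (\<lambda>x. g (v x)) h \<and> deriv_bound d \<delta> k (comp_const M K (Suc k) / \<delta>) h"
    if i: "i < d" for i
  proof -
    from Suc.prems(2)[OF i] obtain v' where v': "has_partial d i v v'" "deriv_bound d \<delta> (Suc k) (K / \<delta>) v'"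
      by blast
    have "deriv_bound d \<delta> k (comp_const M K k) (\<lambda>x. g' (v x))"
      using Suc.prems(2) deriv_bound_SucD by (intro Suc.IH g'(2)) blast
    from deriv_bound_mult[OF this deriv_bound_SucD[OF v'(2)] \<delta>]
    have "deriv_bound d \<delta> k (comp_const M K (Suc k) / \<delta>) (\<lambda>x. g' (v x) * v' x)"
    proof (rule deriv_bound_mono)
      have "2 ^ k * comp_const M K k * K / \<delta> \<le> comp_const M K (Suc k) / \<delta>"
        using \<delta> by (intro divide_right_mono) auto
      then show "2 ^ k * comp_const M K k * (K / \<delta>) \<le> comp_const M K (Suc k) / \<delta>"
        by simp
    qed (fact \<delta>)
    moreover have "has_partial d i (\<lambda>x. g (v x)) (\<lambda>x. g' (v x) * v' x)"
      by (rule has_partial_compose[OF v'(1) g'(1)])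
    ultimately show ?thesis
      by blast
  qed
  moreover have "continuous_on (cube d) (\<lambda>x. g (v x))"
    using Suc.prems(1) by (auto intro: continuous_on_compose2[OF _ v])
  moreover have "\<bar>g (v x)\<bar> \<le> comp_const M K (Suc k)" for x
    using Suc.prems(1) by (auto simp: le_max_iff_disj)
  ultimately show ?case
    by simp
qed

section \<open>The log-partition function of a point set\<close>

text \<open>
  A cloud of \<open>n\<close> points \<open>y k\<close> is turned into a smooth function that is small near the cloud and large
  away from it, on the length scale \<open>\<delta>\<close>. The partition function is a sum of product bumps
  \<open>\<Prod>\<^sub>j sech ((x\<^sub>j - y\<^sub>j) / \<delta>)\<close>, and \<open>- (1 / d) ln\<close> of it is a soft minimum over the cloud of the
  coordinate averages of \<open>ln cosh ((x\<^sub>j - y\<^sub>j) / \<delta>)\<close>. The logarithmic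
  derivatives of a bump are \<open>- 1 / \<delta>\<close> times the slopes below; \<open>sech\<close> is chosen because this makes
  the slopes values of \<open>tanh\<close>, which is bounded with all its derivatives. The averages are expectations over the cloud for
  the Gibbs weights \<open>weight k x / partition_fun x\<close>.
\<close>

locale point_cloud =
  fixes d n :: nat and \<delta> :: real and y :: "nat \<Rightarrow> nat \<Rightarrow> real"
  assumes dim_pos: "d \<ge> 1" and size_pos: "n \<ge> 1" and \<delta>_pos: "\<delta> > 0"
begin

definition weight :: "nat \<Rightarrow> (nat \<Rightarrow> real) \<Rightarrow> real" where
  "weight k x = (\<Prod>j<d. 1 / cosh ((x j - y k j) / \<delta>))"

definition partition_fun :: "(nat \<Rightarrow> real) \<Rightarrow> real" where
  "partition_fun x = (\<Sum>k<n. weight k x)"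

definition slope :: "nat \<Rightarrow> nat \<Rightarrow> (nat \<Rightarrow> real) \<Rightarrow> real" where
  "slope i k x = tanh ((x i - y k i) / \<delta>)"

definition average :: "(nat \<Rightarrow> (nat \<Rightarrow> real) \<Rightarrow> real) \<Rightarrow> (nat \<Rightarrow> real) \<Rightarrow> real" where
  "average a x = (\<Sum>k<n. a k x * weight k x) / partition_fun x"

definition log_partition :: "(nat \<Rightarrow> real) \<Rightarrow> real" where
  "log_partition x = - (ln (partition_fun x) / real d)"

lemma weight_pos: "weight k x > 0"
  by (simp add: weight_def prod_pos)

lemma partition_fun_pos: "partition_fun x > 0"
  unfolding partition_fun_def using size_pos weight_pos by (intro sum_pos) (auto simp: lessThan_empty_iff)

lemma average_times: "average a x * partition_fun x = (\<Sum>k<n. a k x * weight k x)"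
  using partition_fun_pos[of x] by (simp add: average_def)

lemma continuous_on_weight: "continuous_on (cube d) (weight k)"
  unfolding weight_def[abs_def]
  by (intro continuous_intros continuous_on_product_then_coordinatewise[OF continuous_on_id]) (use \<delta>_pos in auto)

lemma continuous_on_partition_fun: "continuous_on (cube d) partition_fun"
  unfolding partition_fun_def[abs_def] by (intro continuous_intros continuous_on_weight)

lemma continuous_on_average:
  assumes "\<And>k. k < n \<Longrightarrow> continuous_on (cube d) (a k)"
  shows "continuous_on (cube d) (average a)"
  unfolding average_def[abs_def]
  using assms partition_fun_pos
  by (intro continuous_intros continuous_on_weight continuous_on_partition_fun) (auto simp: less_imp_neq[symmetric])

lemma continuous_on_log_partition: "continuous_on (cube d) log_partition"
  unfolding log_partition_def[abs_def]
  using partition_fun_pos dim_pos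
  by (intro continuous_intros continuous_on_partition_fun) (auto simp: less_imp_neq[symmetric])

lemma abs_average_le:
  assumes "\<And>k. k < n \<Longrightarrow> \<bar>a k x\<bar> \<le> K"
  shows "\<bar>average a x\<bar> \<le> K"
proof -
  have "\<bar>\<Sum>k<n. a k x * weight k x\<bar> \<le> (\<Sum>k<n. K * weight k x)"
    using assms weight_pos
    by (intro order_trans[OF sum_abs sum_mono]) (auto simp: abs_mult abs_of_pos intro!: mult_right_mono less_imp_le)
  also have "\<dots> = K * partition_fun x"
    by (simp add: partition_fun_def sum_distrib_left)
  finally show ?thesis
    using partition_fun_pos[of x] by (simp add: average_def abs_divide abs_of_pos divide_le_eq)
qed

lemma has_partial_weight:
  assumes "i < d"
  shows "has_partial d i (weight k) (\<lambda>x. - (1 / \<delta>) * (slope i k x * weight k x))"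
  unfolding has_partial_def
proof
  fix x :: "nat \<Rightarrow> real"
  define R where "R = (\<Prod>j\<in>{..<d} - {i}. 1 / cosh ((x j - y k j) / \<delta>))"
  have weight: "weight k (x(i := t)) = 1 / cosh ((t - y k i) / \<delta>) * R" for t
    using assms by (simp add: weight_def R_def prod.remove[of "{..<d}" i])
  have "((\<lambda>t. 1 / cosh ((t - y k i) / \<delta>) * R) has_real_derivative
      - (1 / \<delta>) * (tanh ((x i - y k i) / \<delta>) * (1 / cosh ((x i - y k i) / \<delta>) * R))) (at (x i) within {0..1})"
    using \<delta>_pos
    by (auto intro!: derivative_eq_intros simp: tanh_def power2_eq_square field_simps)
  moreover have "1 / cosh ((x i - y k i) / \<delta>) * R = weight k x"
    using weight[of "x i"] by simp
  ultimately show "((\<lambda>t. weight k (x(i := t))) has_real_derivative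
      - (1 / \<delta>) * (slope i k x * weight k x)) (at (x i) within {0..1})"
    by (simp only: weight slope_def)
qed

lemma has_partial_partition_fun:
  assumes "i < d"
  shows "has_partial d i partition_fun (\<lambda>x. - (1 / \<delta>) * (average (slope i) x * partition_fun x))"
proof -
  have "has_partial d i partition_fun (\<lambda>x. \<Sum>k<n. - (1 / \<delta>) * (slope i k x * weight k x))"
    unfolding partition_fun_def[abs_def]
    by (rule has_partial_sum[OF has_partial_weight[OF assms]])
  also have "(\<lambda>x. \<Sum>k<n. - (1 / \<delta>) * (slope i k x * weight k x)) =
      (\<lambda>x. - (1 / \<delta>) * (average (slope i) x * partition_fun x))"
    using partition_fun_pos
    by (simp add: fun_eq_iff average_def sum_distrib_left sum_negf less_imp_neq[symmetric])
  finally show ?thesis .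
qed

text \<open>
  Differentiating a Gibbs average gives the average of the derivatives minus a covariance with the
  slopes. The right-hand side consists again of products of averages, so the formula can be iterated.
  It is written with additions and scalar multiples to match the closure rules of derivative bounds.
\<close>

lemma has_partial_average:
  assumes "i < d" and a': "\<And>k. k < n \<Longrightarrow> has_partial d i (a k) (a' k)"
  shows "has_partial d i (average a) (\<lambda>x. average a' x +
    (- (1 / \<delta>)) * (average (\<lambda>k x. a k x * slope i k x) x + (- 1) * (average a x * average (slope i) x)))"
proof -
  define N where "N x = (\<Sum>k<n. a k x * weight k x)" for x
  define N' where "N' x = (\<Sum>k<n. a' k x * weight k x + (- (1 / \<delta>) * (slope i k x * weight k x)) * a k x)" for x
  have N: "has_partial d i N N'"
    unfolding N_def[abs_def] N'_def[abs_def]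
    by (intro has_partial_sum has_partial_mult a' has_partial_weight assms(1)) simp
  have *: "has_partial d i (\<lambda>x. N x / partition_fun x) (\<lambda>x. (N' x * partition_fun x -
      N x * (- (1 / \<delta>) * (average (slope i) x * partition_fun x))) / (partition_fun x * partition_fun x))"
    by (rule has_partial_divide[OF N has_partial_partition_fun[OF assms(1)]])
       (use partition_fun_pos in \<open>auto simp: less_imp_neq[symmetric]\<close>)
  have N'_eq: "N' x = average a' x * partition_fun x -
      1 / \<delta> * (average (\<lambda>k x. a k x * slope i k x) x * partition_fun x)" for x
    unfolding average_times N'_def
    by (simp add: sum.distrib sum_subtractf sum_distrib_left sum_negf mult_ac)
  have N_eq: "N x = average a x * partition_fun x" for x
    by (simp add: N_def average_times)
  have eq: "(N' x * partition_fun x -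
      N x * (- (1 / \<delta>) * (average (slope i) x * partition_fun x))) / (partition_fun x * partition_fun x)
    = average a' x + (- (1 / \<delta>)) * (average (\<lambda>k x. a k x * slope i k x) x + (- 1) * (average a x * average (slope i) x))" for x
    using partition_fun_pos[of x] \<delta>_pos unfolding N'_eq N_eq
    by (simp add: field_simps)
  have "average a = (\<lambda>x. N x / partition_fun x)"
    by (simp add: fun_eq_iff average_def N_def)
  then show ?thesis
    using * unfolding eq by simp
qed

text \<open>
  The factor \<open>1 / d\<close> is the source of the factor \<open>d\<close> in the lower bound: every derivative of the soft
  minimum, of whatever order and mixture, is smaller by \<open>d\<close> than its length scale suggests.
\<close>

lemma has_partial_log_partition:
  assumes "i < d"
  shows "has_partial d i log_partition (\<lambda>x. 1 / (real d * \<delta>) * average (slope i) x)"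
proof -
  have "has_partial d i (\<lambda>x. (\<lambda>s. - (ln s / real d)) (partition_fun x))
      (\<lambda>x. (\<lambda>s. - (1 / s / real d)) (partition_fun x) * (- (1 / \<delta>) * (average (slope i) x * partition_fun x)))"
    by (rule has_partial_compose[OF has_partial_partition_fun[OF assms]])
       (use partition_fun_pos dim_pos in \<open>auto intro!: derivative_eq_intros\<close>)
  also have "(\<lambda>x. (\<lambda>s. - (1 / s / real d)) (partition_fun x) * (- (1 / \<delta>) * (average (slope i) x * partition_fun x)))
      = (\<lambda>x. 1 / (real d * \<delta>) * average (slope i) x)"
    using partition_fun_pos by (simp add: fun_eq_iff less_imp_neq[symmetric] mult.commute)
  finally show ?thesis
    by (simp add: log_partition_def[abs_def])
qed

end

text \<open>
  One step accounts for the three terms of the covariance formula: the average of the derivatives,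
  the average of the products with the slopes, and the product of the averages.
\<close>

primrec average_const :: "real \<Rightarrow> nat \<Rightarrow> real" where
  "average_const T 0 = 1"
| "average_const T (Suc k) = max 1 (average_const T k * (1 + 2 ^ k * T + 2 ^ k * average_const T k * T))"

lemma average_const_ge_1: "average_const T k \<ge> 1"
  by (cases k) auto

context point_cloud
begin

text \<open>
  An average of functions is bounded like the functions themselves, and by the covariance formula
  this persists for derivatives. The constant depends neither on the number of points nor on the
  dimension.
\<close>

lemma deriv_bound_average:
  assumes slope: "\<And>i k. i < d \<Longrightarrow> k < n \<Longrightarrow> deriv_bound d \<delta> r T (slope i k)"
    and "\<And>k. k < n \<Longrightarrow> deriv_bound d \<delta> m K (a k)" "m \<le> r"
  shows "deriv_bound d \<delta> m (average_const T m * K) (average a)"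
  using assms(2,3)
proof (induction m arbitrary: a K)
  case 0
  then show ?case
    by (auto intro!: continuous_on_average abs_average_le)
next
  case (Suc m)
  have K: "K \<ge> 0"
    using deriv_bound_nonneg[OF Suc.prems(1)[of 0]] size_pos by simp
  have a: "deriv_bound d \<delta> m K (a k)" if "k < n" for k
    using deriv_bound_SucD[OF Suc.prems(1)[OF that]] .
  \<comment> \<open>The bound on the slopes is given for the order \<open>r\<close> and is passed down to \<open>m\<close>.\<close>
  have SucD: "deriv_bound d \<delta> m T (slope i k)" if "i < d" "k < n" for i k
  proof -
    have "deriv_bound d \<delta> (r - l) T (slope i k)" for l
    proof (induction l)
      case (Suc l)
      then show ?case
        using deriv_bound_SucD[of d \<delta> "r - Suc l" T "slope i k"]
        by (cases "l < r") (auto simp: Suc_diff_Suc)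
    qed (use slope that in auto)
    from this[of "r - m"] show ?thesis
      using Suc.prems(2) by simp
  qed
  define A where "A = average_const T m"
  have "\<exists>g. has_partial d i (average a) g \<and> deriv_bound d \<delta> m (average_const T (Suc m) * K / \<delta>) g"
    if i: "i < d" for i
  proof -
    have "\<exists>a'. \<forall>k<n. has_partial d i (a k) (a' k) \<and> deriv_bound d \<delta> m (K / \<delta>) (a' k)"
      using Suc.prems(1) i by (intro choice) (auto elim!: deriv_bound_SucE[OF _ i])
    then obtain a' where a': "\<And>k. k < n \<Longrightarrow> has_partial d i (a k) (a' k)"
      "\<And>k. k < n \<Longrightarrow> deriv_bound d \<delta> m (K / \<delta>) (a' k)"
      by blast
    have 1: "deriv_bound d \<delta> m (A * (K / \<delta>)) (average a')"
      unfolding A_def using Suc.prems(2) by (intro Suc.IH a'(2)) auto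
    have 2: "deriv_bound d \<delta> m (A * (2 ^ m * K * T)) (average (\<lambda>k x. a k x * slope i k x))"
      unfolding A_def using Suc.prems(2) by (intro Suc.IH deriv_bound_mult a SucD i \<delta>_pos) auto
    have 3: "deriv_bound d \<delta> m (A * K) (average a)"
      unfolding A_def using Suc.prems(2) by (intro Suc.IH a) auto
    have 4: "deriv_bound d \<delta> m (A * T) (average (slope i))"
      unfolding A_def using Suc.prems(2) by (intro Suc.IH SucD i) auto
    have bound: "deriv_bound d \<delta> m
        (A * (K / \<delta>) + \<bar>- (1 / \<delta>)\<bar> * (A * (2 ^ m * K * T) + \<bar>- 1\<bar> * (2 ^ m * (A * K) * (A * T))))
        (\<lambda>x. average a' x +
          (- (1 / \<delta>)) * (average (\<lambda>k x. a k x * slope i k x) x + (- 1) * (average a x * average (slope i) x)))"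
      by (intro deriv_bound_add deriv_bound_cmult deriv_bound_mult 1 2 3 4 \<delta>_pos)
    have "A * (K / \<delta>) + \<bar>- (1 / \<delta>)\<bar> * (A * (2 ^ m * K * T) + \<bar>- 1\<bar> * (2 ^ m * (A * K) * (A * T)))
        = A * (1 + 2 ^ m * T + 2 ^ m * A * T) * K / \<delta>"
      using \<delta>_pos by (simp add: abs_of_pos distrib_left distrib_right add_divide_distrib mult_ac)
    also have "\<dots> \<le> average_const T (Suc m) * K / \<delta>"
      using \<delta>_pos K by (intro divide_right_mono mult_right_mono) (auto simp: A_def)
    finally have "deriv_bound d \<delta> m (average_const T (Suc m) * K / \<delta>) (\<lambda>x. average a' x +
          (- (1 / \<delta>)) * (average (\<lambda>k x. a k x * slope i k x) x + (- 1) * (average a x * average (slope i) x)))"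
      using deriv_bound_mono[OF bound _ \<delta>_pos] by blast
    moreover note has_partial_average[of i a a', OF i a'(1)]
    ultimately show ?thesis
      by blast
  qed
  moreover have "\<bar>average a x\<bar> \<le> average_const T (Suc m) * K" if "x \<in> cube d" for x
  proof -
    have "\<bar>average a x\<bar> \<le> 1 * K"
      using deriv_bound_abs_le[OF Suc.prems(1) that] by (simp add: abs_average_le)
    also have "\<dots> \<le> average_const T (Suc m) * K"
      using K average_const_ge_1 by (intro mult_right_mono) auto
    finally show ?thesis .
  qed
  moreover have "continuous_on (cube d) (average a)"
    using Suc.prems(1) deriv_bound_continuous by (blast intro: continuous_on_average)
  ultimately show ?case
    by simp
qed

lemma deriv_bound_slope:
  assumes "smooth_bounded r M tanh" "i < d"
  shows "deriv_bound d \<delta> r (comp_const M 1 r) (slope i k)"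
  unfolding slope_def[abs_def]
proof (rule deriv_bound_compose[OF assms(1) _ \<delta>_pos])
  show "continuous_on (cube d) (\<lambda>x. (x i - y k i) / \<delta>)"
    by (intro continuous_intros continuous_on_product_then_coordinatewise[OF continuous_on_id]) (use \<delta>_pos in auto)
  fix l assume "l < d"
  define c where "c = (if l = i then 1 / \<delta> else 0)"
  have "has_partial d l (\<lambda>x. (x i - y k i) / \<delta>) (\<lambda>_. c)"
    using \<delta>_pos by (auto simp: has_partial_def c_def intro!: derivative_eq_intros)
  moreover have "deriv_bound d \<delta> r (1 / \<delta>) (\<lambda>_. c)"
    using \<delta>_pos by (intro deriv_bound_const) (auto simp: c_def)
  ultimately show "\<exists>v'. has_partial d l (\<lambda>x. (x i - y k i) / \<delta>) v' \<and> deriv_bound d \<delta> r (1 / \<delta>) v'"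
    by blast
qed

lemma log_partition_point:
  assumes "k < n"
  shows "log_partition (y k) \<le> 0"
proof -
  have "weight k (y k) \<le> partition_fun (y k)"
    unfolding partition_fun_def using assms weight_pos
    by (intro member_le_sum) (auto intro: less_imp_le)
  moreover have "weight k (y k) = 1"
    by (simp add: weight_def)
  ultimately show ?thesis
    by (simp add: log_partition_def)
qed

text \<open>
  Each bump is a product, and its factors \<open>sech ((t - z) / \<delta>)\<close> have the antiderivative
  \<open>2 \<delta> arctan (exp ((t - z) / \<delta>))\<close>, so their integrals are at most \<open>\<pi> \<delta>\<close>.
\<close>

lemma integral_partition_fun_le: "integral_cube d partition_fun \<le> real n * (4 * \<delta>) ^ d"
proof -
  have one: "0 \<le> integral {0..1} (\<lambda>t. 1 / cosh ((t - z) / \<delta>)) \<and>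
      integral {0..1} (\<lambda>t. 1 / cosh ((t - z) / \<delta>)) \<le> 4 * \<delta>" for z
  proof -
    define G where "G t = 2 * \<delta> * arctan (exp ((t - z) / \<delta>))" for t
    have "((\<lambda>t. 1 / cosh ((t - z) / \<delta>)) has_integral (G 1 - G 0)) {0..1}"
    proof (rule fundamental_theorem_of_calculus)
      fix t
      have "(G has_real_derivative
          2 * \<delta> * (exp ((t - z) / \<delta>) * (1 / \<delta>) * inverse (1 + exp ((t - z) / \<delta>) ^ 2))) (at t within {0..1})"
        unfolding G_def[abs_def] using \<delta>_pos
        by (auto intro!: derivative_eq_intros simp: field_simps)
      moreover have "2 * \<delta> * (exp ((t - z) / \<delta>) * (1 / \<delta>) * inverse (1 + exp ((t - z) / \<delta>) ^ 2)) =
          1 / cosh ((t - z) / \<delta>)"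
      proof -
        define e where "e = exp ((t - z) / \<delta>)"
        have e: "e > 0"
          by (simp add: e_def)
        have "cosh ((t - z) / \<delta>) = (e + 1 / e) / 2"
          by (simp add: cosh_field_def exp_minus e_def inverse_eq_divide)
        also have "\<dots> = (1 + e\<^sup>2) / (2 * e)"
          using e by (simp add: field_simps power2_eq_square)
        finally have "1 / cosh ((t - z) / \<delta>) = 2 * e / (1 + e\<^sup>2)"
          by simp
        then show ?thesis
          using \<delta>_pos by (simp add: e_def divide_inverse)
      qed
      ultimately show "(G has_vector_derivative 1 / cosh ((t - z) / \<delta>)) (at t within {0..1})"
        by (simp add: has_real_derivative_iff_has_vector_derivative)
    qed simp
    then have "integral {0..1} (\<lambda>t. 1 / cosh ((t - z) / \<delta>)) = G 1 - G 0"
      by (rule integral_unique)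
    also have "\<dots> \<le> 2 * \<delta> * (pi / 2) - 0"
      unfolding G_def using \<delta>_pos arctan_ubound[of "exp ((1 - z) / \<delta>)"]
      by (intro diff_mono mult_left_mono) (auto intro: less_imp_le)
    also have "\<dots> \<le> 4 * \<delta>"
      using pi_less_4 \<delta>_pos by simp
    finally have "integral {0..1} (\<lambda>t. 1 / cosh ((t - z) / \<delta>)) \<le> 4 * \<delta>" .
    moreover have "0 \<le> integral {0..1} (\<lambda>t. 1 / cosh ((t - z) / \<delta>))"
      by (intro Henstock_Kurzweil_Integration.integral_nonneg integrable_continuous_real continuous_intros)
         (use \<delta>_pos in auto)
    ultimately show ?thesis
      by blast
  qed
  have cont: "continuous_on {0..1} (\<lambda>t. 1 / cosh ((t - z) / \<delta>))" for z
    by (intro continuous_intros) (use \<delta>_pos in auto)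
  have "integral_cube d partition_fun = (\<Sum>k<n. integral_cube d (weight k))"
    unfolding partition_fun_def[abs_def] by (rule integral_cube_sum[OF continuous_on_weight])
  also have "\<dots> \<le> (\<Sum>k<n. (4 * \<delta>) ^ d)"
  proof (rule sum_mono)
    fix k
    have "integral_cube d (weight k) = (\<Prod>j<d. integral {0..1} (\<lambda>t. 1 / cosh ((t - y k j) / \<delta>)))"
      unfolding weight_def[abs_def] by (rule integral_cube_prod[OF cont])
    also have "\<dots> \<le> (\<Prod>j<d. 4 * \<delta>)"
      using one by (intro prod_mono) auto
    finally show "integral_cube d (weight k) \<le> (4 * \<delta>) ^ d"
      by simp
  qed
  finally show ?thesis
    by simp
qed

end

section \<open>Fooling functions\<close>

lemma ramp_eventually_large: "\<exists>s>0. ramp s ^ j \<ge> 2 / 3"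
proof -
  have "((\<lambda>s :: real. tanh s ^ j) \<longlongrightarrow> 1 ^ j) at_top"
    by (intro tendsto_power tanh_real_at_top)
  then have "\<forall>\<^sub>F s in at_top. tanh s ^ j > (2 / 3 :: real)"
    by (rule order_tendstoD) simp
  then have "\<forall>\<^sub>F s in at_top. tanh s ^ j > (2 / 3 :: real) \<and> s > 0"
    by (intro eventually_conj eventually_gt_at_top)
  then obtain s :: real where "tanh s ^ j > 2 / 3" "s > 0"
    by (auto dest!: eventually_happens'[OF trivial_limit_at_top_linorder])
  then show ?thesis
    by (intro exI[of _ s]) (simp add: ramp_def max_def)
qed

lemma ramp_mono: "s \<le> t \<Longrightarrow> ramp s \<le> ramp t"
  by (simp add: ramp_def)

text \<open>
  The fooling function is \<open>f = \<mu> \<cdot> ramp (u) ^ (r + 1)\<close> with the soft minimum \<open>u = log_partition\<close> of the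
  cloud at scale \<open>\<delta> = \<epsilon> n powr (- 1 / d)\<close>. At the points of the cloud \<open>u \<le> 0\<close>, hence \<open>f = 0\<close>.
  Since the partition function has integral at most \<open>n (4 \<delta>) ^ d = (4 \<epsilon>) ^ d\<close>, it is below
  \<open>exp (- s d)\<close> on most of the cube if \<open>\<epsilon>\<close> is small, and there \<open>u \<ge> s\<close> and \<open>f \<ge> 2 / 3 \<cdot> \<mu>\<close>. The
  derivatives of \<open>f\<close> of order \<open>j \<ge> 1\<close> are at most \<open>\<mu> C / (d \<delta> ^ j)\<close>, which permits the height
  \<open>\<mu> = min 1 (d \<delta> ^ r / C)\<close>.
\<close>

theorem fooling_function:
  assumes "r \<ge> 1"
  shows "\<exists>c>0. \<forall>d n y. d \<ge> 1 \<longrightarrow> n \<ge> 1 \<longrightarrow>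
    (\<exists>f. f \<in> smooth_class r d \<and> (\<lambda>x. - f x) \<in> smooth_class r d \<and> (\<forall>k<n. f (y k) = 0) \<and>
      min (1 / 2) (c * real d * real n powr (- (real r / real d))) \<le> integral_cube d f)"
proof -
  define p where "p = r - 1"
  have r: "r = Suc p"
    using assms by (simp add: p_def)
  obtain s where s: "s > 0" "ramp s ^ Suc r \<ge> 2 / 3"
    using ramp_eventually_large by blast
  obtain M1 where M1: "smooth_bounded p M1 tanh"
    using smooth_bounded_tanh_power[of p 1] by auto
  obtain M2 where M2: "smooth_bounded r M2 (\<lambda>s. ramp s ^ Suc r)"
    using smooth_bounded_ramp_power[of r "Suc r"] by auto
  then obtain ramp' where ramp': "\<And>s. ((\<lambda>s. ramp s ^ Suc r) has_real_derivative ramp' s) (at s)"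
    "smooth_bounded p M2 ramp'"
    unfolding r by auto
  define T where "T = comp_const M1 1 p"
  define B where "B = average_const T p * T"
  define C where "C = max 1 (2 ^ p * comp_const M2 B p * B)"
  \<comment> \<open>Chosen such that \<open>exp (s d) \<cdot> n (4 \<delta>) ^ d = (1 / 4) ^ d\<close>.\<close>
  define \<epsilon> where "\<epsilon> = exp (- s) / 16"
  have \<epsilon>: "0 < \<epsilon>" "\<epsilon> \<le> 1"
    using s by (auto simp: \<epsilon>_def intro: order_trans[of _ 1])
  have C: "C \<ge> 1"
    by (simp add: C_def)
  define c where "c = \<epsilon> ^ r / C / 2"
  have "\<exists>f. f \<in> smooth_class r d \<and> (\<lambda>x. - f x) \<in> smooth_class r d \<and> (\<forall>k<n. f (y k) = 0) \<and>
      min (1 / 2) (c * real d * real n powr (- (real r / real d))) \<le> integral_cube d f"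
    if d: "d \<ge> 1" and n: "n \<ge> 1" for d n and y :: "nat \<Rightarrow> nat \<Rightarrow> real"
  proof -
    define \<delta> where "\<delta> = \<epsilon> * real n powr (- (1 / real d))"
    have \<delta>: "0 < \<delta>"
      using \<epsilon> n by (simp add: \<delta>_def)
    have "real n powr (- (1 / real d)) \<le> real n powr 0"
      using n by (intro powr_mono) auto
    then have "\<delta> \<le> 1 * 1"
      unfolding \<delta>_def using \<epsilon> n by (intro mult_mono) auto
    then have \<delta>_le: "\<delta> \<le> 1"
      by simp
    interpret point_cloud d n \<delta> y
      using d n \<delta> by unfold_locales
    define \<mu> where "\<mu> = min 1 (real d * \<delta> ^ r / C)"
    have \<mu>: "0 \<le> \<mu>" "\<mu> \<le> 1"
      using \<delta> C by (auto simp: \<mu>_def)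
    define f where "f x = \<mu> * ramp (log_partition x) ^ Suc r" for x
    have f_cont: "continuous_on (cube d) f"
      unfolding f_def[abs_def] ramp_def
      by (intro continuous_intros continuous_on_log_partition) auto
    have slope: "deriv_bound d \<delta> p T (slope i k)" if "i < d" for i k
      unfolding T_def by (rule deriv_bound_slope[OF M1 that])
    have average: "deriv_bound d \<delta> p B (average (slope i))" if "i < d" for i
      unfolding B_def by (rule deriv_bound_average[OF slope slope[OF that]]) auto
    have B: "B \<ge> 0"
      using deriv_bound_nonneg[OF average[of 0]] d by simp
    have u': "deriv_bound d \<delta> p (B / (real d * \<delta>)) (\<lambda>x. 1 / (real d * \<delta>) * average (slope i) x)" if "i < d" for i
      using deriv_bound_cmult[OF average[OF that], of "1 / (real d * \<delta>)"] \<delta> by simp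
    have le: "B / (real d * \<delta>) \<le> B / \<delta>"
      using \<delta> d B by (intro divide_left_mono) (auto simp: mult_le_cancel_right1)
    have outer: "deriv_bound d \<delta> p (comp_const M2 B p) (\<lambda>x. ramp' (log_partition x))"
    proof (rule deriv_bound_compose[OF ramp'(2) continuous_on_log_partition \<delta>])
      fix i assume "i < d"
      then show "\<exists>v'. has_partial d i log_partition v' \<and> deriv_bound d \<delta> p (B / \<delta>) v'"
        using has_partial_log_partition deriv_bound_mono[OF u' le \<delta>] by blast
    qed
    have "\<exists>g. has_partial d i f g \<and> deriv_bound d 1 p (1 / 1) g" if i: "i < d" for i
    proof -
      define g where "g x = \<mu> * (ramp' (log_partition x) * (1 / (real d * \<delta>) * average (slope i) x))" for x
      have "has_partial d i f g"
        unfolding f_def[abs_def] g_def[abs_def]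
        by (intro has_partial_cmult has_partial_compose[OF has_partial_log_partition[OF i] ramp'(1)])
      moreover have "deriv_bound d \<delta> p (\<bar>\<mu>\<bar> * (2 ^ p * comp_const M2 B p * (B / (real d * \<delta>)))) g"
        unfolding g_def[abs_def] by (intro deriv_bound_cmult deriv_bound_mult outer u' i \<delta>)
      then have "deriv_bound d 1 p 1 g"
      proof (rule deriv_bound_rescale[OF _ \<delta> \<delta>_le])
        have "\<bar>\<mu>\<bar> * (2 ^ p * comp_const M2 B p * (B / (real d * \<delta>))) =
            \<mu> * (2 ^ p * comp_const M2 B p * B) / (real d * \<delta>)"
          using \<mu> by simp
        also have "\<dots> \<le> (real d * \<delta> ^ r / C) * C / (real d * \<delta>)"
        proof (intro divide_right_mono)
          have "\<mu> * (2 ^ p * comp_const M2 B p * B) \<le> \<mu> * C"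
            using \<mu> by (intro mult_left_mono) (auto simp: C_def)
          also have "\<dots> \<le> (real d * \<delta> ^ r / C) * C"
            using C by (intro mult_right_mono) (auto simp: \<mu>_def)
          finally show "\<mu> * (2 ^ p * comp_const M2 B p * B) \<le> (real d * \<delta> ^ r / C) * C" .
        qed (use \<delta> in auto)
        also have "\<dots> = \<delta> ^ p"
          using \<delta> C d by (simp add: r)
        finally show "\<bar>\<mu>\<bar> * (2 ^ p * comp_const M2 B p * (B / (real d * \<delta>))) \<le> \<delta> ^ p" .
      qed
      ultimately show ?thesis
        by auto
    qed
    moreover have "\<bar>f x\<bar> \<le> 1" for x
    proof -
      have "\<bar>\<mu>\<bar> * \<bar>ramp (log_partition x) ^ Suc r\<bar> \<le> 1 * 1"
        using \<mu> abs_ramp_power_le_1[of _ "Suc r"] by (intro mult_mono) (auto simp del: power_Suc)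
      then show ?thesis
        by (simp add: f_def abs_mult)
    qed
    ultimately have f: "deriv_bound d 1 r 1 f"
      using f_cont by (simp add: r)
    from deriv_bound_cmult[OF this, of "- 1"] have "deriv_bound d 1 r 1 (\<lambda>x. - f x)"
      by simp
    then have "(\<lambda>x. - f x) \<in> smooth_class r d"
      by (rule deriv_bound_imp_smooth_class)
    moreover have "f (y k) = 0" if "k < n" for k
      using log_partition_point[OF that] by (simp add: f_def ramp_def)
    moreover have "min (1 / 2) (c * real d * real n powr (- (real r / real d))) \<le> integral_cube d f"
    proof -
      define E where "E = exp (s * real d)"
      \<comment> \<open>A linear lower bound in the partition function replaces Markov's inequality: where the
        partition function exceeds \<open>exp (- s d)\<close> the left-hand side is negative.\<close>
      have pointwise: "\<mu> * (2 / 3) * (1 + (- E) * partition_fun x) \<le> f x" for x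
      proof (cases "E * partition_fun x \<le> 1")
        case True
        then have "partition_fun x \<le> exp (- (s * real d))"
          by (simp add: E_def exp_minus field_simps)
        then have "ln (partition_fun x) \<le> - (s * real d)"
          using ln_le_cancel_iff[OF partition_fun_pos exp_gt_zero, of x "- (s * real d)"] by simp
        then have "s \<le> log_partition x"
          using d by (simp add: log_partition_def field_simps)
        then have "ramp s ^ Suc r \<le> ramp (log_partition x) ^ Suc r"
          by (intro power_mono ramp_mono ramp_nonneg)
        then have "2 / 3 \<le> ramp (log_partition x) ^ Suc r"
          using s by linarith
        moreover have "0 \<le> E * partition_fun x"
          using partition_fun_pos[of x] by (simp add: E_def)
        ultimately have "2 / 3 * (1 + (- E) * partition_fun x) \<le> ramp (log_partition x) ^ Suc r"
          by (simp del: power_Suc)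
        then show ?thesis
          unfolding f_def mult.assoc using \<mu> by (intro mult_left_mono)
      next
        case False
        then have "\<mu> * (2 / 3) * (1 + (- E) * partition_fun x) \<le> 0"
          using \<mu> by (intro mult_nonneg_nonpos) auto
        also have "0 \<le> f x"
          using \<mu> ramp_nonneg by (simp add: f_def)
        finally show ?thesis .
      qed
      have "E * integral_cube d partition_fun \<le> E * (real n * (4 * \<delta>) ^ d)"
        by (intro mult_left_mono integral_partition_fun_le) (simp add: E_def)
      also have "E * (real n * (4 * \<delta>) ^ d) = (1 / 4) ^ d"
      proof -
        have "E = exp s ^ d"
          by (simp add: E_def exp_of_nat2_mult mult.commute)
        moreover have "real n = (real n powr (1 / real d)) ^ d"
          using n d by (simp add: powr_realpow[symmetric] powr_powr)
        ultimately have "E * (real n * (4 * \<delta>) ^ d) = (exp s * (real n powr (1 / real d) * (4 * \<delta>))) ^ d"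
          by (simp add: power_mult_distrib)
        also have "exp s * (real n powr (1 / real d) * (4 * \<delta>)) = 1 / 4"
          using n by (simp add: \<delta>_def \<epsilon>_def exp_minus powr_minus field_simps)
        finally show ?thesis .
      qed
      also have "\<dots> \<le> (1 / 4) ^ 1"
        using d by (intro power_decreasing) auto
      finally have small: "E * integral_cube d partition_fun \<le> 1 / 4"
        by simp
      \<comment> \<open>Height \<open>2 / 3\<close> outside an exceptional mass of \<open>1 / 4\<close> yields exactly one half.\<close>
      have "\<mu> / 2 = \<mu> * (2 / 3) * (1 - 1 / 4)"
        by simp
      also have "\<dots> \<le> \<mu> * (2 / 3) * (1 + (- E) * integral_cube d partition_fun)"
        using small \<mu> by (intro mult_left_mono) auto
      also have "\<dots> = integral_cube d (\<lambda>x. \<mu> * (2 / 3) * (1 + (- E) * partition_fun x))"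
        by (simp only: integral_cube_cmult integral_cube_const
            integral_cube_add[OF continuous_on_const continuous_on_mult_left[OF continuous_on_partition_fun]])
      also have "\<dots> \<le> integral_cube d f"
        by (intro integral_cube_mono pointwise f_cont continuous_intros continuous_on_partition_fun)
      finally have "\<mu> / 2 \<le> integral_cube d f" .
      moreover have "min (1 / 2) (c * real d * real n powr (- (real r / real d))) = \<mu> / 2"
      proof -
        have "(real n powr (- (1 / real d))) ^ r = real n powr (- (real r / real d))"
          using n by (simp add: powr_realpow[symmetric] powr_powr)
        then have "\<delta> ^ r = \<epsilon> ^ r * real n powr (- (real r / real d))"
          by (simp add: \<delta>_def power_mult_distrib)
        then have "real d * \<delta> ^ r / C = 2 * (c * real d * real n powr (- (real r / real d)))"
          by (simp add: c_def)
        then show ?thesis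
          by (simp add: \<mu>_def min_def)
      qed
      ultimately show ?thesis
        by simp
    qed
    ultimately show ?thesis
      using deriv_bound_imp_smooth_class[OF f] by blast
  qed
  moreover have "c > 0"
    using \<epsilon> C by (simp add: c_def)
  ultimately show ?thesis
    by blast
qed

text \<open>
  Adaption and nonlinearity do not help. Run the algorithm on the zero function and let \<open>f\<close> vanish at
  the points \<open>y k\<close> that it samples. Then \<open>f\<close> and \<open>- f\<close> produce the same data as the zero function and
  the same output, although their integrals differ by twice the integral of \<open>f\<close>.
\<close>

lemma minimal_error_ge:
  assumes "\<And>y :: nat \<Rightarrow> nat \<Rightarrow> real. \<exists>f. f \<in> smooth_class r d \<and> (\<lambda>x. - f x) \<in> smooth_class r d \<and>
    (\<forall>k<n. f (y k) = 0) \<and> b \<le> integral_cube d f"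
  shows "ereal b \<le> minimal_error r d n"
  unfolding minimal_error_def
proof (rule INF_greatest)
  fix A assume "A \<in> algorithms d n"
  then obtain X \<phi> where A: "A = (\<lambda>f. \<phi> (sample_values X f n))"
    by (auto simp: algorithms_def)
  define y where "y k = X (sample_values X (\<lambda>_. 0) k)" for k
  obtain f where f: "f \<in> smooth_class r d" "(\<lambda>x. - f x) \<in> smooth_class r d"
    and zero: "\<And>k. k < n \<Longrightarrow> f (y k) = 0" and b: "b \<le> integral_cube d f"
    using assms[of y] by blast
  have same_values: "sample_values X g n = sample_values X (\<lambda>_. 0) n" if "\<And>k. k < n \<Longrightarrow> g (y k) = 0" for g
  proof -
    have "sample_values X g k = sample_values X (\<lambda>_. 0) k" if "k \<le> n" for k
      using that by (induction k) (auto simp: \<open>\<And>k. k < n \<Longrightarrow> g (y k) = 0\<close>[unfolded y_def])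
    then show ?thesis
      by simp
  qed
  define a where "a = \<phi> (sample_values X (\<lambda>_. 0) n)"
  have Af: "A f = a" "A (\<lambda>x. - f x) = a"
    using same_values[of f] same_values[of "\<lambda>x. - f x"] zero by (simp_all add: A a_def)
  have neg: "integral_cube d (\<lambda>x. - f x) = - integral_cube d f"
    using integral_cube_cmult[of d "- 1" f] by simp
  have "b \<le> \<bar>integral_cube d f - a\<bar> \<or> b \<le> \<bar>- integral_cube d f - a\<bar>"
    using b by linarith
  then show "ereal b \<le> worst_case_error r d A"
  proof
    assume "b \<le> \<bar>integral_cube d f - a\<bar>"
    then show ?thesis
      unfolding worst_case_error_def by (intro SUP_upper2[OF f(1)]) (simp add: Af(1))
  next
    assume "b \<le> \<bar>- integral_cube d f - a\<bar>"
    then show ?thesis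
      unfolding worst_case_error_def
      by (intro SUP_upper2[OF f(2)]) (simp add: Af(2) neg)
  qed
qed

theorem theorem2:
  fixes r :: nat
  assumes "r \<ge> 1"
  shows "\<exists>c1 c2 :: real. c1 > 0 \<and> c2 > 0 \<and>
    (\<forall>d n :: nat. d \<ge> 1 \<longrightarrow> n \<ge> 1 \<longrightarrow>
      ereal (min (1 / 2) (c1 * real d * real n powr (- (real r / real d)))) \<le> minimal_error r d n \<and>
      ((\<exists>m::nat. m \<ge> 1 \<and> n = m ^ d) \<longrightarrow>
        minimal_error r d n \<le> ereal (min 1 (c2 * real d * real n powr (- (real r / real d))))) \<and>
      minimal_error r d n \<le>
        ereal (if n = 1 then 1
               else min 1 (c2 * real d * (real n powr (1 / real d) - 1) powr (- real r))))"
proof -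
  obtain c1 where c1: "c1 > 0" and fool: "\<And>d n y. d \<ge> 1 \<Longrightarrow> n \<ge> 1 \<Longrightarrow>
    (\<exists>f. f \<in> smooth_class r d \<and> (\<lambda>x. - f x) \<in> smooth_class r d \<and> (\<forall>k<n. f (y k) = 0) \<and>
      min (1 / 2) (c1 * real d * real n powr (- (real r / real d))) \<le> integral_cube d f)"
    using fooling_function[OF assms] by blast
  obtain c2 where c2: "c2 > 0" and upper: "\<And>d m n. m \<ge> 1 \<Longrightarrow> d \<ge> 1 \<Longrightarrow> m ^ d \<le> n \<Longrightarrow>
    minimal_error r d n \<le> ereal (min 1 (c2 * real d * (1 / real m) ^ r))"
    using minimal_error_upper_bound[OF assms] by blast
  have lower: "ereal (min (1 / 2) (c1 * real d * real n powr (- (real r / real d)))) \<le> minimal_error r d n"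
    if "d \<ge> 1" "n \<ge> 1" for d n
    by (rule minimal_error_ge[OF fool[OF that]])
  have power: "minimal_error r d (m ^ d) \<le>
      ereal (min 1 (c2 * real d * real (m ^ d) powr (- (real r / real d))))"
    if d: "d \<ge> 1" and m: "m \<ge> 1" for d m
  proof -
    have "real (m ^ d) powr (- (real r / real d)) = (1 / real m) ^ r"
      using d m by (simp add: powr_realpow[symmetric] powr_powr powr_minus power_one_over inverse_eq_divide)
    then show ?thesis
      using upper[OF m d order_refl] by simp
  qed
  have general: "minimal_error r d n \<le>
      ereal (if n = 1 then 1 else min 1 (c2 * real d * (real n powr (1 / real d) - 1) powr (- real r)))"
    if d: "d \<ge> 1" and n: "n \<ge> 1" for d n
  proof (cases "n = 1")
    case True
    then show ?thesis
      using minimal_error_le_1[of r d n] by (simp add: one_ereal_def)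
  next
    case False
    \<comment> \<open>Of the \<open>n\<close> function values only \<open>m ^ d\<close> are used, for the largest possible \<open>m\<close>.\<close>
    define q where "q = real n powr (1 / real d)"
    define m where "m = nat \<lfloor>q\<rfloor>"
    have q: "q > 1"
      using n d False by (simp add: q_def gr_one_powr)
    then have m: "m \<ge> 1" "real m \<le> q" "q - 1 \<le> real m"
      unfolding m_def by linarith+
    have "real (m ^ d) \<le> q ^ d"
      using m by (simp add: power_mono)
    also have "\<dots> = real n"
      using n d by (simp add: q_def powr_realpow[symmetric] powr_powr)
    finally have "m ^ d \<le> n"
      by simp
    note upper[OF m(1) d this]
    also have "ereal (min 1 (c2 * real d * (1 / real m) ^ r)) \<le> ereal (min 1 (c2 * real d * (q - 1) powr (- real r)))"
    proof -
      have "(1 / real m) ^ r \<le> (1 / (q - 1)) ^ r"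
        using m q by (intro power_mono divide_left_mono) auto
      also have "\<dots> = (q - 1) powr (- real r)"
        using q by (simp add: powr_minus powr_realpow power_one_over inverse_eq_divide)
      finally have "c2 * real d * (1 / real m) ^ r \<le> c2 * real d * (q - 1) powr (- real r)"
        using c2 by (intro mult_left_mono) auto
      then show ?thesis
        by (simp add: min.coboundedI2 min_le_iff_disj)
    qed
    finally show ?thesis
      using False by (simp add: q_def)
  qed
  show ?thesis
  proof (intro exI conjI allI impI)
    fix d n :: nat
    assume d: "d \<ge> 1" and n: "n \<ge> 1"
    show "ereal (min (1 / 2) (c1 * real d * real n powr (- (real r / real d)))) \<le> minimal_error r d n"
      by (rule lower[OF d n])
    show "minimal_error r d n \<le>
        ereal (if n = 1 then 1 else min 1 (c2 * real d * (real n powr (1 / real d) - 1) powr (- real r)))"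
      by (rule general[OF d n])
    assume "\<exists>m::nat. m \<ge> 1 \<and> n = m ^ d"
    then obtain m where m: "m \<ge> 1" and n_eq: "n = m ^ d"
      by blast
    show "minimal_error r d n \<le> ereal (min 1 (c2 * real d * real n powr (- (real r / real d))))"
      unfolding n_eq by (rule power[OF d m])
  qed (fact c1 c2)+
qed

end
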